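(* Let $n\in\mathbb{N}_0$, $\mu\in(-1/2,\infty)\setminus\{0\}$, $\lambda\in\mathbb{C}$, $\rho\in(0,1)$. With $R=\sqrt{1+\rho^2-2\rho x}$, $$\int_{-1}^1\frac{(1-x^2)^{\mu/2-1/4}}{R^{1/2-\mu+\lambda}}\,\mathrm{P}_{\mu-\lambda-1/2}^{1/2-\mu}\!\left(\frac{1-\rho x}{R}\right)C_n^\mu(x)\,dx=\frac{(\lambda)_n\,\sqrt{\pi}\,\rho^{n+\mu-1/2}\,2^{1/2-\mu}}{(n+\mu)\,\Gamma(\mu)\,n!}.$$
   Context: $\mathbb{N}_0=\{0,1,2,\dots\}$. $(z)_n=\prod_{i=1}^n(z+i-1)$ is the Pochhammer symbol. ${}_2F_1$ is the Gauss hypergeometric function, analytically continued to $\mathbb{C}\setminus[1,\infty)$. The Gegenbauer polynomials are $C_n^\mu(z)=\frac{(2\mu)_n}{n!}\,{}_2F_1(-n,n+2\mu;\mu+\frac12;\frac{1-z}{2})$. The Ferrers function of the first kind on $(-1,1)$ is $\mathrm{P}_\nu^\mu(x)=\frac{1}{\Gamma(1-\mu)}\left(\frac{1+x}{1-x}\right)^{\mu/2}{}_2F_1(-\nu,\nu+1;1-\mu;\frac{1-x}{2})$. *)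

theory Defs
  imports "HOL-Analysis.Analysis"
begin

definition hyp_cut_plane :: "complex set" where
  "hyp_cut_plane = - (complex_of_real ` {1..})"

(* Gauss hypergeometric function, for c not in {0, -1, -2, ...}.  Within its disc of convergence
   (the whole plane when the series terminates, the unit disc otherwise) it is the sum of the
   series; elsewhere on the plane cut along [1, \<infinity>) it is the analytic continuation of that sum,
   which is unique by the identity theorem.  No value is prescribed on the cut itself in the
   nonterminating case. *)
definition hyp2F1 :: "complex \<Rightarrow> complex \<Rightarrow> complex \<Rightarrow> complex \<Rightarrow> complex" where
  "hyp2F1 a b c z =
     (let F = fps_hypergeo [a, b] [c] 1 in
      if ereal (norm z) < fps_conv_radius F then eval_fps F z
      else (SOME f. f holomorphic_on hyp_cut_plane \<and> (\<forall>w\<in>ball 0 1. f w = eval_fps F w)) z)"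

definition gegenbauer_C :: "nat \<Rightarrow> complex \<Rightarrow> complex \<Rightarrow> complex" where
  "gegenbauer_C n \<mu> z =
     pochhammer (2 * \<mu>) n / fact n *
     hyp2F1 (- of_nat n) (of_nat n + 2 * \<mu>) (\<mu> + 1 / 2) ((1 - z) / 2)"

(* Meaningful for -1 < x < 1 and \<mu> not in {1, 2, 3, ...}; the base of the power is then positive,
   so that the principal value is the intended one. *)
definition ferrers_P :: "complex \<Rightarrow> complex \<Rightarrow> real \<Rightarrow> complex" where
  "ferrers_P \<nu> \<mu> x =
     1 / Gamma (1 - \<mu>) * complex_of_real ((1 + x) / (1 - x)) powr (\<mu> / 2) *
     hyp2F1 (- \<nu>) (\<nu> + 1) (1 - \<mu>) (complex_of_real ((1 - x) / 2))"

end

theory Submission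
  imports Defs "HOL-Complex_Analysis.Complex_Analysis"
begin

text \<open>
  Put \<open>y = (1 - \<rho> x) / R\<close>. For \<open>-1 < x < 1\<close> one has \<open>0 < y < 1\<close>, so the Ferrers function is
  evaluated at \<open>(1 - y) / 2 < 1/2\<close>, inside the unit disc of the hypergeometric series.
  Euler's transformation (\<open>Euler_transformation\<close>) and \<open>R\<^sup>2 (1 - y\<^sup>2) = \<rho>\<^sup>2 (1 - x\<^sup>2)\<close>
  (\<open>weight_simplification\<close>) turn the algebraic prefactors of the integrand into the Gegenbauer weight
  \<open>(1 - x\<^sup>2) powr (\<mu> - 1/2)\<close>, up to a constant, and leave the factor
  \<open>G(\<rho>) = R powr (-\<lambda>) * F (\<lambda>, 2 \<mu> - \<lambda>; \<mu> + 1/2; (1 - y) / 2)\<close>.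

  This factor is a generating function of Gegenbauer polynomials. With \<open>c_k = C_k / C_k(1)\<close>,
  \<open>G(\<rho>) = (\<Sum>k. (\<lambda>)_k / k! * c_k(x) * \<rho>^k)\<close>
  (\<open>gegenbauer_generating_function\<close>). Geometrically, \<open>G\<close> is the axially symmetric, homogeneous harmonic
  function of degree \<open>-\<lambda>\<close> in dimension \<open>2 \<mu> + 2\<close>, expanded about a point of the axis at
  distance 1 from the origin.
  Analytically, for fixed \<open>x\<close> it solves a linear second-order equation in \<open>\<rho>\<close> which is singular at
  \<open>\<rho> = 0\<close> with exponents \<open>0\<close> and \<open>1 - 2 \<mu>\<close>. As \<open>1 - 2 \<mu>\<close> is not a positive integer,
  the power series solution with constant term 1 is unique, and the coefficient recurrence is
  the three-term recurrence of the \<open>c_k\<close>. The identity theorem carries the equality from a neighbourhood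
  of \<open>0\<close> to all of \<open>[0, 1)\<close>; a domain containing this segment suffices, which
  avoids studying \<open>y\<close> as a function on the whole complex disc.

  It remains to integrate against \<open>C_n\<close>. The \<open>c_k\<close> are orthogonal for the weight
  (\<open>zonal_orthogonal\<close>, \<open>zonal_norm\<close>), and the series converges uniformly on \<open>[-1, 1]\<close> by the bound
  \<open>norm_zonal_le\<close>, so only the term \<open>k = n\<close> survives (\<open>generating_function_projection\<close>).
\<close>

section \<open>The Gauss hypergeometric series\<close>

abbreviation gauss_fps :: "complex \<Rightarrow> complex \<Rightarrow> complex \<Rightarrow> complex fps" where
  "gauss_fps a b c \<equiv> fps_hypergeo [a, b] [c] 1"

lemma gauss_fps_Suc:
  assumes "c + of_nat n \<noteq> 0"
  shows "of_nat (Suc n) * (c + of_nat n) * fps_nth (gauss_fps a b c) (Suc n) =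
    (a + of_nat n) * (b + of_nat n) * fps_nth (gauss_fps a b c) n"
  using assms unfolding fps_hypergeo_rec by (simp del: of_nat_Suc fps_hypergeo_nth)

text \<open>
  Passing between differential equation and recurrence in both directions makes the differential equation
  a tool for identifying power series.
\<close>

lemma hypergeometric_ode_iff:
  fixes f :: "complex fps"
  shows "fps_X * (1 - fps_X) * fps_deriv (fps_deriv f)
      + (fps_const c - fps_const (a + b + 1) * fps_X) * fps_deriv f - fps_const (a * b) * f = 0 \<longleftrightarrow>
    (\<forall>n. of_nat (Suc n) * (c + of_nat n) * fps_nth f (Suc n) = (a + of_nat n) * (b + of_nat n) * fps_nth f n)"
    (is "?L = 0 \<longleftrightarrow> _")
proof -
  have "fps_nth ?L n = of_nat (Suc n) * (c + of_nat n) * fps_nth f (Suc n)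
      - (a + of_nat n) * (b + of_nat n) * fps_nth f n" for n
  proof -
    have "?L = fps_X * fps_deriv (fps_deriv f) - fps_X * (fps_X * fps_deriv (fps_deriv f))
      + fps_const c * fps_deriv f - fps_const (a + b + 1) * (fps_X * fps_deriv f) - fps_const (a * b) * f"
      by (simp add: algebra_simps)
    then show ?thesis
      by (cases n; cases "n - 1") (auto simp: algebra_simps)
  qed
  then show ?thesis by (simp add: fps_eq_iff del: of_nat_Suc)
qed

lemma gauss_fps_unique:
  fixes f g :: "complex fps"
  assumes "\<And>n. c + of_nat n \<noteq> 0"
    and "\<And>n. of_nat (Suc n) * (c + of_nat n) * fps_nth f (Suc n) = (a + of_nat n) * (b + of_nat n) * fps_nth f n"
    and "fps_nth f 0 = 1"
  shows "f = gauss_fps a b c"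
proof (rule fps_ext)
  fix n show "fps_nth f n = fps_nth (gauss_fps a b c) n"
  proof (induction n)
    case (Suc n)
    have "of_nat (Suc n) * (c + of_nat n) * fps_nth f (Suc n)
        = of_nat (Suc n) * (c + of_nat n) * fps_nth (gauss_fps a b c) (Suc n)"
      using assms(2)[of n] gauss_fps_Suc[of c n a b] assms(1) Suc by (simp del: fps_hypergeo_nth of_nat_Suc)
    moreover have "of_nat (Suc n) * (c + of_nat n) \<noteq> 0" using assms(1) by (simp del: of_nat_Suc)
    ultimately show ?case by (simp only: mult_cancel_left) blast
  qed (use assms in simp)
qed

lemma fps_conv_radius_gauss_fps:
  "fps_conv_radius (gauss_fps a b c) \<ge> 1" if c: "\<And>n. c + of_nat n \<noteq> 0"
  unfolding fps_conv_radius_def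
proof (rule conv_radius_geI_ex)
  fix r :: real assume r: "r > 0" "ereal r < 1"
  let ?f = "fps_nth (gauss_fps a b c)"
  obtain q where q: "r < q" "q < 1" using r dense by auto
  have "(\<lambda>n. norm ((a + of_nat n) * (b + of_nat n) / (of_nat (Suc n) * (c + of_nat n))) * r)
      \<longlonglongrightarrow> norm ((1 * 1) / (1 * 1) :: complex) * r"
  proof -
    have lim: "(\<lambda>n. (d + of_nat n) / of_nat n :: complex) \<longlonglongrightarrow> 1" for d
    proof -
      have "(\<lambda>n. d / of_nat n + 1 :: complex) \<longlonglongrightarrow> 0 + 1"
        by (intro tendsto_intros lim_const_over_n)
      then show ?thesis
        by (rule Lim_transform_eventually[OF tendsto_eq_rhs])
          (simp, rule eventually_mono[OF eventually_gt_at_top[of 0]], simp add: field_simps)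
    qed
    have "(\<lambda>n. norm (((a + of_nat n) / of_nat n * ((b + of_nat n) / of_nat n)) /
        ((1 + of_nat n) / of_nat n * ((c + of_nat n) / of_nat n))) * r) \<longlonglongrightarrow> norm ((1 * 1) / (1 * 1) :: complex) * r"
      by (intro tendsto_intros lim) auto
    moreover have "p / w * (q / w) / (s / w * (t / w)) = p * q / (s * t)" if "w \<noteq> 0" for p q s t w :: complex
      using that by simp
    ultimately show ?thesis
      by (elim Lim_transform_eventually)
        (rule eventually_mono[OF eventually_gt_at_top[of 0]], simp)
  qed
  then have "\<forall>\<^sub>F n in sequentially. norm ((a + of_nat n) * (b + of_nat n) / (of_nat (Suc n) * (c + of_nat n))) * r < q"
    by (rule order_tendstoD(2)) (use q in simp)
  then obtain N where N: "\<And>n. n \<ge> N \<Longrightarrow>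
      norm ((a + of_nat n) * (b + of_nat n) / (of_nat (Suc n) * (c + of_nat n))) * r < q"
    by (auto simp: eventually_at_top_linorder)
  have "summable (\<lambda>n. ?f n * of_real r ^ n)"
  proof (rule summable_ratio_test[OF q(2)])
    fix n assume n: "n \<ge> N"
    have nz: "of_nat (Suc n) * (c + of_nat n) \<noteq> 0" using c by (simp del: of_nat_Suc)
    have "?f (Suc n) = (a + of_nat n) * (b + of_nat n) / (of_nat (Suc n) * (c + of_nat n)) * ?f n"
      using gauss_fps_Suc[OF c, of n a b] nz by (simp add: field_simps del: fps_hypergeo_nth of_nat_Suc)
    then have "norm (?f (Suc n) * of_real r ^ Suc n) =
        norm ((a + of_nat n) * (b + of_nat n) / (of_nat (Suc n) * (c + of_nat n))) * r * norm (?f n * of_real r ^ n)"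
      using r by (simp add: norm_mult norm_divide norm_power del: fps_hypergeo_nth of_nat_Suc)
    also have "\<dots> \<le> q * norm (?f n * of_real r ^ n)"
      using N[OF n] by (intro mult_right_mono) auto
    finally show "norm (?f (Suc n) * of_real r ^ Suc n) \<le> q * norm (?f n * of_real r ^ n)" .
  qed
  then show "\<exists>z. norm z = r \<and> summable (\<lambda>n. ?f n * z ^ n)"
    using r by (intro exI[of _ "complex_of_real r"]) auto
qed

lemma fps_conv_radius_terminating:
  "fps_conv_radius (gauss_fps (- of_nat n) b c) = \<infinity>"
  unfolding fps_conv_radius_def
proof (rule conv_radius_inftyI'')
  show "summable (\<lambda>k. fps_nth (gauss_fps (- of_nat n) b c) k * z ^ k)" for z
    by (rule summable_finite[of "{..n}"]) (auto simp: pochhammer_of_nat_eq_0_iff)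
qed

lemma hyp2F1_eq_eval_fps:
  assumes "\<And>n. c + of_nat n \<noteq> 0" "norm z < 1"
  shows "hyp2F1 a b c z = eval_fps (gauss_fps a b c) z"
proof -
  have "ereal (norm z) < 1" using assms(2) by simp
  also have "\<dots> \<le> fps_conv_radius (gauss_fps a b c)" by (rule fps_conv_radius_gauss_fps[OF assms(1)])
  finally show ?thesis by (simp add: hyp2F1_def)
qed

lemma hyp2F1_terminating:
  "hyp2F1 (- of_nat n) b c z = eval_fps (gauss_fps (- of_nat n) b c) z"
  by (simp add: hyp2F1_def fps_conv_radius_terminating)

lemma fps_hypergeometric_ode:
  assumes "\<And>n. c + of_nat n \<noteq> 0"
  shows "fps_X * (1 - fps_X) * fps_deriv (fps_deriv (gauss_fps a b c))
      + (fps_const c - fps_const (a + b + 1) * fps_X) * fps_deriv (gauss_fps a b c)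
      - fps_const (a * b) * gauss_fps a b c = 0"
  unfolding hypergeometric_ode_iff using gauss_fps_Suc assms by blast

lemma sums_fps_X_mult:
  fixes g :: "complex fps"
  assumes "(\<lambda>n. fps_nth g n * z ^ n) sums y"
  shows "(\<lambda>n. fps_nth (fps_X * g) n * z ^ n) sums (z * y)"
proof -
  have "(\<lambda>n. fps_nth (fps_X * g) (Suc n) * z ^ Suc n) sums (z * y)"
    using sums_mult[OF assms, of z] by (simp add: mult_ac)
  then show ?thesis by (subst (asm) sums_Suc_iff) simp
qed

lemma sums_fps_const_mult:
  fixes g :: "complex fps"
  assumes "(\<lambda>n. fps_nth g n * z ^ n) sums y"
  shows "(\<lambda>n. fps_nth (fps_const d * g) n * z ^ n) sums (d * y)"
  using sums_mult[OF assms, of d] by (simp add: mult_ac)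

lemma eval_hypergeometric_ode:
  assumes c: "\<And>n. c + of_nat n \<noteq> 0" and z: "ereal (norm z) < fps_conv_radius (gauss_fps a b c)"
  defines "f \<equiv> gauss_fps a b c"
  shows "z * (1 - z) * eval_fps (fps_deriv (fps_deriv f)) z
      + (c - (a + b + 1) * z) * eval_fps (fps_deriv f) z - a * b * eval_fps f z = 0"
proof -
  have r0: "norm z < fps_conv_radius f" using z f_def by simp
  have r1: "norm z < fps_conv_radius (fps_deriv f)"
    using r0 fps_conv_radius_deriv[of f] by (rule less_le_trans)
  have r2: "norm z < fps_conv_radius (fps_deriv (fps_deriv f))"
    using r1 fps_conv_radius_deriv[of "fps_deriv f"] by (rule less_le_trans)
  define e where "e = a + b + 1"
  let ?L = "fps_X * fps_deriv (fps_deriv f) - fps_X * (fps_X * fps_deriv (fps_deriv f))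
      + fps_const c * fps_deriv f - fps_const e * (fps_X * fps_deriv f) - fps_const (a * b) * f"
  have "?L = 0"
    using fps_hypergeometric_ode[OF c, of a b] unfolding f_def[symmetric] e_def[symmetric]
    by (simp add: algebra_simps)
  moreover have "(\<lambda>n. fps_nth ?L n * z ^ n) sums
     (z * eval_fps (fps_deriv (fps_deriv f)) z - z * (z * eval_fps (fps_deriv (fps_deriv f)) z)
      + c * eval_fps (fps_deriv f) z - e * (z * eval_fps (fps_deriv f) z) - a * b * eval_fps f z)"
    unfolding fps_sub_nth fps_add_nth ring_distribs left_diff_distrib
    by (intro sums_add sums_diff sums_fps_X_mult sums_fps_const_mult sums_eval_fps r0 r1 r2)
  ultimately have "z * eval_fps (fps_deriv (fps_deriv f)) z - z * (z * eval_fps (fps_deriv (fps_deriv f)) z)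
      + c * eval_fps (fps_deriv f) z - e * (z * eval_fps (fps_deriv f) z) - a * b * eval_fps f z = 0"
    by (simp add: sums_iff)
  then show ?thesis unfolding e_def by (simp add: algebra_simps)
qed

text \<open>
  Multiplying a solution of the equation with parameters \<open>c - a\<close>, \<open>c - b\<close>, \<open>c\<close> by
  \<open>B = (1 - X) powr (c - a - b)\<close> yields a solution of the equation with parameters \<open>a\<close>, \<open>b\<close>, \<open>c\<close>;
  the series is then determined by its constant term. Only
  \<open>(1 - X) B' = - (c - a - b) B\<close> enters the computation.
\<close>

lemma Euler_fps:
  assumes c: "\<And>n. c + of_nat n \<noteq> 0"
  shows "gauss_fps a b c =
    fps_compose (fps_binomial (c - a - b)) (- fps_X) * gauss_fps (c - a) (c - b) c"
proof -
  define k where "k = c - a - b"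
  define B where "B = fps_compose (fps_binomial k) (- fps_X)"
  define f where "f = gauss_fps (c - a) (c - b) c"
  have dB: "(1 - fps_X) * fps_deriv B = - (fps_const k * B)"
  proof -
    have e: "fps_nth B n = (k gchoose n) * (-1) ^ n" for n
      unfolding B_def fps_compose_uminus' by simp
    have g: "(of_nat n + 1) * (k gchoose Suc n) = (k - of_nat n) * (k gchoose n)" for n
      by (metis add.commute of_nat_Suc gbinomial_absorption gbinomial_absorb_comp)
    show ?thesis
    proof (rule fps_ext)
      fix n
      have "(1 - fps_X) * fps_deriv B = fps_deriv B - fps_X * fps_deriv B" by (simp add: algebra_simps)
      then show "fps_nth ((1 - fps_X) * fps_deriv B) n = fps_nth (- (fps_const k * B)) n"
        using arg_cong[OF g[of n], of "\<lambda>t. t * (-1) ^ n"] by (cases n) (auto simp: e algebra_simps)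
    qed
  qed
  have ode: "fps_X * (1 - fps_X) * fps_deriv (fps_deriv f)
      + (fps_const c - fps_const (c - a + (c - b) + 1) * fps_X) * fps_deriv f
      - fps_const ((c - a) * (c - b)) * f = 0"
    unfolding f_def by (rule fps_hypergeometric_ode[OF c])
  show ?thesis
  proof (rule gauss_fps_unique[symmetric, of c])
    let ?E = "B * f"
    have ddB: "(1 - fps_X) * fps_deriv (fps_deriv B) = fps_deriv B - fps_const k * fps_deriv B"
    proof -
      have "fps_deriv ((1 - fps_X) * fps_deriv B) = fps_deriv (- (fps_const k * B))" by (simp only: dB)
      then show ?thesis by (simp add: algebra_simps)
    qed
    \<comment> \<open>The derivatives of \<open>B\<close> are only known after multiplication by \<open>1 - X\<close>, hence the extra factor,
      which is cancelled at the end.\<close>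
    have "(1 - fps_X) * (fps_X * (1 - fps_X) * fps_deriv (fps_deriv ?E)
      + (fps_const c - fps_const (a + b + 1) * fps_X) * fps_deriv ?E - fps_const (a * b) * ?E) = 0"
    proof -
      define B1 where "B1 = fps_deriv B"
      define B2 where "B2 = fps_deriv B1"
      define f1 where "f1 = fps_deriv f"
      define f2 where "f2 = fps_deriv f1"
      define X where "X = (fps_X :: complex fps)"
      define C where "C = fps_const c"
      define A where "A = fps_const a"
      define D where "D = fps_const b"
      have k: "fps_const k = C - A - D" by (simp add: k_def C_def A_def D_def)
      have one: "fps_const 1 = (1 :: complex fps)" by simp
      have 1: "(1 - X) * B1 = - ((C - A - D) * B)" using dB by (simp add: k X_def B1_def)
      have 2: "(1 - X) * B2 = B1 - (C - A - D) * B1" using ddB by (simp add: k X_def B1_def B2_def)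
      have 3: "X * (1 - X) * f2 + (C - (C - A + (C - D) + 1) * X) * f1 - ((C - A) * (C - D)) * f = 0"
      proof -
        have "fps_const (c - a + (c - b) + 1) = C - A + (C - D) + 1"
          "fps_const ((c - a) * (c - b)) = (C - A) * (C - D)"
          by (simp_all only: C_def A_def D_def fps_const_add fps_const_sub fps_const_mult fps_const_1_eq_1[symmetric])
        then show ?thesis using ode unfolding X_def f2_def f1_def C_def[symmetric] by simp
      qed
      have e: "fps_deriv (fps_deriv ?E) = B2 * f + 2 * B1 * f1 + B * f2"
        by (simp add: B1_def B2_def f1_def f2_def algebra_simps)
      have e1: "fps_deriv ?E = B1 * f + B * f1" by (simp add: B1_def f1_def)
      have "(1 - X) * (X * (1 - X) * (B2 * f + 2 * B1 * f1 + B * f2)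
         + (C - (A + D + 1) * X) * (B1 * f + B * f1) - (A * D) * (B * f)) = 0"
        using 1 2 3 by algebra
      moreover have "fps_const (a + b + 1) = A + D + 1" "fps_const (a * b) = A * D"
        by (simp_all only: A_def D_def fps_const_add fps_const_mult fps_const_1_eq_1[symmetric])
      ultimately show ?thesis unfolding e unfolding e1 unfolding X_def C_def by simp
    qed
    moreover have "(1 - fps_X :: complex fps) \<noteq> 0"
      by (metis fps_X_neq_fps_const fps_const_1_eq_1 right_minus_eq)
    ultimately have "fps_X * (1 - fps_X) * fps_deriv (fps_deriv ?E)
      + (fps_const c - fps_const (a + b + 1) * fps_X) * fps_deriv ?E - fps_const (a * b) * ?E = 0"
      by (simp only: mult_eq_0_iff) blast
    then show "of_nat (Suc n) * (c + of_nat n) * fps_nth (fps_compose (fps_binomial (c - a - b)) (- fps_X) * gauss_fps (c - a) (c - b) c) (Suc n)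
      = (a + of_nat n) * (b + of_nat n) * fps_nth (fps_compose (fps_binomial (c - a - b)) (- fps_X) * gauss_fps (c - a) (c - b) c) n" for n
      unfolding hypergeometric_ode_iff B_def f_def k_def by blast
  qed (use c in simp_all)
qed

lemma Euler_transformation:
  assumes c: "\<And>n. c + of_nat n \<noteq> 0" and z: "norm z < 1"
  shows "eval_fps (gauss_fps a b c) z = (1 - z) powr (c - a - b) * eval_fps (gauss_fps (c - a) (c - b) c) z"
proof -
  define B where "B = fps_compose (fps_binomial (c - a - b)) (- fps_X)"
  have s: "(\<lambda>n. fps_nth B n * w ^ n) sums (1 - w) powr (c - a - b)" if "norm w < 1" for w
    using gen_binomial_complex[of "- w" "c - a - b"] that
    by (simp add: B_def fps_compose_uminus' power_minus[of w] mult_ac)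
  have r: "fps_conv_radius B \<ge> 1"
    unfolding fps_conv_radius_def
  proof (rule conv_radius_geI_ex')
    show "summable (\<lambda>n. fps_nth B n * of_real r ^ n)" if "0 < r" "ereal r < 1" for r
      using s[of "of_real r"] that by (auto simp: sums_iff)
  qed
  have z1: "ereal (norm z) < 1" using z by simp
  have "eval_fps (gauss_fps a b c) z = eval_fps B z * eval_fps (gauss_fps (c - a) (c - b) c) z"
    unfolding Euler_fps[OF c, of a b] B_def[symmetric]
    by (rule eval_fps_mult) (use z1 r fps_conv_radius_gauss_fps[OF c] less_le_trans in blast)+
  then show ?thesis using s[OF z] by (simp add: eval_fps_def sums_iff)
qed

section \<open>Normalised Gegenbauer polynomials\<close>

text \<open>
  The substitution \<open>z = (1 - y) / 2\<close> in the hypergeometric equation. It serves twice: with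
  \<open>a = -n\<close> for the polynomials, and with \<open>a = \<lambda>\<close> for the factor \<open>G\<close> of the integrand.
\<close>

lemma ultraspherical_ode:
  fixes m a b y :: complex
  assumes c: "\<And>n. m + 1 / 2 + of_nat n \<noteq> 0" and ab: "a + b = 2 * m"
  defines "f \<equiv> gauss_fps a b (m + 1 / 2)"
  defines "h \<equiv> \<lambda>y. eval_fps f ((1 - y) / 2)"
    and "h' \<equiv> \<lambda>y. - eval_fps (fps_deriv f) ((1 - y) / 2) / 2"
    and "h'' \<equiv> \<lambda>y. eval_fps (fps_deriv (fps_deriv f)) ((1 - y) / 2) / 4"
  assumes y: "ereal (norm ((1 - y) / 2)) < fps_conv_radius f"
  shows "(h has_field_derivative h' y) (at y)" "(h' has_field_derivative h'' y) (at y)"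
    "(1 - y\<^sup>2) * h'' y - (2 * m + 1) * y * h' y - a * b * h y = 0"
proof -
  have y1: "ereal (norm ((1 - y) / 2)) < fps_conv_radius (fps_deriv f)"
    using y fps_conv_radius_deriv[of f] by (rule less_le_trans)
  have d: "((\<lambda>y. (1 - y) / 2) has_field_derivative - 1 / 2) (at y)"
    by (auto intro!: derivative_eq_intros)
  show "(h has_field_derivative h' y) (at y)"
    using DERIV_chain2[OF has_field_derivative_eval_fps[OF y] d] by (simp add: h_def h'_def)
  show "(h' has_field_derivative h'' y) (at y)"
    using DERIV_cdivide[OF DERIV_minus[OF DERIV_chain2[OF has_field_derivative_eval_fps[OF y1] d]], of 2]
    by (simp add: h'_def h''_def)
  have "(1 - y) / 2 * (1 - (1 - y) / 2) * eval_fps (fps_deriv (fps_deriv f)) ((1 - y) / 2)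
      + (m + 1 / 2 - (a + b + 1) * ((1 - y) / 2)) * eval_fps (fps_deriv f) ((1 - y) / 2)
      - a * b * eval_fps f ((1 - y) / 2) = 0"
    using eval_hypergeometric_ode[OF c y[unfolded f_def]] by (simp add: f_def)
  then show "(1 - y\<^sup>2) * h'' y - (2 * m + 1) * y * h' y - a * b * h y = 0"
  proof -
    have "(1 - y) / 2 * (1 - (1 - y) / 2) = (1 - y\<^sup>2) / 4"
      "m + 1 / 2 - (2 * m + 1) * ((1 - y) / 2) = (2 * m + 1) * y / 2"
      by (simp_all add: field_simps power2_eq_square)
    then have "(1 - y\<^sup>2) / 4 * eval_fps (fps_deriv (fps_deriv f)) ((1 - y) / 2)
      + (2 * m + 1) * y / 2 * eval_fps (fps_deriv f) ((1 - y) / 2)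
      - a * b * eval_fps f ((1 - y) / 2) = 0"
      using \<open>_ = 0\<close> by (simp only: ab)
    then show ?thesis unfolding h_def h'_def h''_def by simp
  qed
qed

text \<open>
  The Gegenbauer polynomial divided by its value at 1; for \<open>m = (d - 2) / 2\<close> it is the zonal
  spherical harmonic in dimension \<open>d\<close>.
\<close>

definition zonal :: "complex \<Rightarrow> nat \<Rightarrow> complex \<Rightarrow> complex" where
  "zonal m n x = eval_fps (gauss_fps (- of_nat n) (of_nat n + 2 * m) (m + 1 / 2)) ((1 - x) / 2)"

lemma gegenbauer_C_eq_zonal: "gegenbauer_C n m x = pochhammer (2 * m) n / fact n * zonal m n x"
  by (simp add: gegenbauer_C_def zonal_def hyp2F1_terminating)

lemma zonal_0: "zonal m 0 x = 1"
proof -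
  have "gauss_fps (- of_nat 0) (of_nat 0 + 2 * m) (m + 1 / 2) = 1"
    by (simp add: fps_eq_iff pochhammer_0_left)
  then show ?thesis by (simp only: zonal_def eval_fps_1)
qed

text \<open>
  Three-term recurrence of the \<open>zonal\<close> polynomials at the level of the coefficient of \<open>((1 - x) / 2) ^ Suc k\<close>. With a complex
  \<open>s\<close> in place of the degree it is a polynomial identity: all terms are multiples of
  \<open>pochhammer (1 - s) j * pochhammer (s + 2 * m + 1) j\<close> where \<open>k = Suc j\<close>.
\<close>

lemma pochhammer_contiguous:
  fixes s m :: complex
  shows "(s + 2 * m) * (pochhammer (- s - 1) (Suc k) * pochhammer (s + 1 + 2 * m) (Suc k)) =
    2 * (s + m) * (pochhammer (- s) (Suc k) * pochhammer (s + 2 * m) (Suc k)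
       - 2 * (m + 1 / 2 + of_nat k) * of_nat (Suc k) * (pochhammer (- s) k * pochhammer (s + 2 * m) k))
    - s * (pochhammer (1 - s) (Suc k) * pochhammer (s - 1 + 2 * m) (Suc k))"
proof (cases k)
  case (Suc j)
  define U where "U = pochhammer (1 - s) j"
  define V where "V = pochhammer (s + 2 * m + 1) j"
  define J :: complex where "J = of_nat j"
  have "pochhammer (1 - s) (Suc (Suc j)) = U * (1 - s + J) * (2 - s + J)"
    by (simp add: pochhammer_Suc U_def J_def algebra_simps)
  moreover have "pochhammer (- s) (Suc (Suc j)) = - s * U * (1 - s + J)"
    by (subst pochhammer_rec, subst pochhammer_Suc) (simp add: U_def J_def)
  moreover have "pochhammer (- s) (Suc j) = - s * U"
    by (subst pochhammer_rec) (simp add: U_def)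
  moreover have "pochhammer (- s - 1) (Suc (Suc j)) = (- s - 1) * (- s) * U"
    by (subst pochhammer_rec, subst pochhammer_rec) (simp add: U_def)
  moreover have "pochhammer (s + 1 + 2 * m) (Suc (Suc j)) = V * (s + 2 * m + 1 + J) * (s + 2 * m + 2 + J)"
    by (simp add: pochhammer_Suc V_def J_def add_ac)
  moreover have "pochhammer (s + 2 * m) (Suc (Suc j)) = (s + 2 * m) * V * (s + 2 * m + 1 + J)"
    by (subst pochhammer_rec, subst pochhammer_Suc) (simp add: V_def J_def)
  moreover have "pochhammer (s + 2 * m) (Suc j) = (s + 2 * m) * V"
    by (subst pochhammer_rec) (simp add: V_def)
  moreover have "pochhammer (s - 1 + 2 * m) (Suc (Suc j)) = (s - 1 + 2 * m) * (s + 2 * m) * V"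
    by (subst pochhammer_rec, subst pochhammer_rec) (simp add: V_def algebra_simps)
  ultimately have "(s + 2 * m) * (pochhammer (- s - 1) (Suc (Suc j)) * pochhammer (s + 1 + 2 * m) (Suc (Suc j))) =
    2 * (s + m) * (pochhammer (- s) (Suc (Suc j)) * pochhammer (s + 2 * m) (Suc (Suc j))
       - (2 * m + 1 + 2 * (J + 1)) * (J + 2) * (pochhammer (- s) (Suc j) * pochhammer (s + 2 * m) (Suc j)))
    - s * (pochhammer (1 - s) (Suc (Suc j)) * pochhammer (s - 1 + 2 * m) (Suc (Suc j)))"
    by algebra
  then show ?thesis unfolding Suc by (simp add: J_def algebra_simps del: pochhammer_Suc)
qed (simp add: algebra_simps power2_eq_square)

lemma zonal_recurrence:
  assumes c: "\<And>n. m + 1 / 2 + of_nat n \<noteq> (0 :: complex)"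
  shows "(of_nat n + 1 + 2 * m) * zonal m (Suc (Suc n)) x =
    2 * (of_nat n + 1 + m) * x * zonal m (Suc n) x - (of_nat n + 1) * zonal m n x"
proof -
  define Z where "Z n = gauss_fps (- of_nat n) (of_nat n + 2 * m) (m + 1 / 2)" for n :: nat
  define t where "t = (1 - x) / 2"
  let ?s = "of_nat n + 1 :: complex"
  have Z: "fps_const (?s + 2 * m) * Z (Suc (Suc n)) =
      fps_const (2 * (?s + m)) * (Z (Suc n) - fps_const 2 * (fps_X * Z (Suc n))) - fps_const ?s * Z n"
  proof (rule fps_ext)
    fix k
    show "fps_nth (fps_const (?s + 2 * m) * Z (Suc (Suc n))) k =
      fps_nth (fps_const (2 * (?s + m)) * (Z (Suc n) - fps_const 2 * (fps_X * Z (Suc n))) - fps_const ?s * Z n) k"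
    proof (cases k)
      case 0
      then show ?thesis by (simp add: Z_def algebra_simps)
    next
      case (Suc j)
      define p where "p s k = pochhammer (- s) k * pochhammer (s + 2 * m) k" for s :: complex and k
      define q where "q k = pochhammer (m + 1 / 2) k * fact k" for k
      have q: "q k \<noteq> 0" for k
        using c by (auto simp: q_def pochhammer_eq_0_iff) (metis add.left_inverse)
      have qS: "q (Suc j) = q j * ((m + 1 / 2 + of_nat j) * of_nat (Suc j))"
        by (simp add: q_def pochhammer_Suc)
      have nth: "fps_nth (Z i) k = p (of_nat i) k / q k" for i k
        by (simp add: Z_def p_def q_def)
      have "(?s + 2 * m) * p (?s + 1) (Suc j) =
        2 * (?s + m) * (p ?s (Suc j) - 2 * ((m + 1 / 2 + of_nat j) * of_nat (Suc j)) * p ?s j) - ?s * p (?s - 1) (Suc j)"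
        using pochhammer_contiguous[of ?s m j] by (simp add: p_def mult.assoc)
      note id = this
      have "(?s + 2 * m) * (p (?s + 1) (Suc j) / q (Suc j)) =
        2 * (?s + m) * (p ?s (Suc j) / q (Suc j) - 2 * (p ?s j / q j)) - ?s * (p (?s - 1) (Suc j) / q (Suc j))"
      proof -
        have "A * (x3 / (y * w)) = B * (x2 / (y * w) - 2 * (x1 / y)) - D * (x0 / (y * w))"
          if "A * x3 = B * (x2 - 2 * w * x1) - D * x0" "y * w \<noteq> 0" for A B D x0 x1 x2 x3 y w :: complex
        proof -
          have "A * (x3 / (y * w)) = (B * (x2 - 2 * w * x1) - D * x0) / (y * w)" by (simp flip: that(1))
          also have "\<dots> = B * (x2 / (y * w) - 2 * (x1 / y)) - D * (x0 / (y * w))"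
            using that(2) by (simp add: field_simps)
          finally show ?thesis .
        qed
        then show ?thesis using id q[of "Suc j"] unfolding qS by blast
      qed
      then show ?thesis unfolding Suc by (simp add: nth add.commute)
    qed
  qed
  have s: "(\<lambda>k. fps_nth (Z i) k * t ^ k) sums zonal m i x" for i
    unfolding zonal_def Z_def t_def
    by (rule sums_eval_fps) (simp add: fps_conv_radius_terminating)
  have "(\<lambda>k. fps_nth (fps_const (?s + 2 * m) * Z (Suc (Suc n))) k * t ^ k) sums ((?s + 2 * m) * zonal m (Suc (Suc n)) x)"
    by (intro sums_fps_const_mult s)
  moreover have "(\<lambda>k. fps_nth (fps_const (2 * (?s + m)) * (Z (Suc n) - fps_const 2 * (fps_X * Z (Suc n))) - fps_const ?s * Z n) k * t ^ k)
     sums (2 * (?s + m) * (zonal m (Suc n) x - 2 * (t * zonal m (Suc n) x)) - ?s * zonal m n x)"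
    unfolding fps_sub_nth left_diff_distrib
  proof -
    have "(\<lambda>k. fps_nth (Z (Suc n) - fps_const 2 * (fps_X * Z (Suc n))) k * t ^ k) sums
        (zonal m (Suc n) x - 2 * (t * zonal m (Suc n) x))"
      unfolding fps_sub_nth left_diff_distrib by (intro sums_diff sums_fps_const_mult sums_fps_X_mult s)
    from sums_diff[OF sums_fps_const_mult[OF this] sums_fps_const_mult[OF s]]
    show "(\<lambda>k. fps_nth (fps_const (2 * (?s + m)) * (Z (Suc n) - fps_const 2 * (fps_X * Z (Suc n)))) k * t ^ k
        - fps_nth (fps_const ?s * Z n) k * t ^ k)
     sums (2 * (?s + m) * (zonal m (Suc n) x - 2 * (t * zonal m (Suc n) x)) - ?s * zonal m n x)" .
  qed
  ultimately have "(?s + 2 * m) * zonal m (Suc (Suc n)) x =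
      2 * (?s + m) * (zonal m (Suc n) x - 2 * (t * zonal m (Suc n) x)) - ?s * zonal m n x"
    unfolding Z by (rule sums_unique2)
  moreover have "zonal m (Suc n) x - 2 * (t * zonal m (Suc n) x) = x * zonal m (Suc n) x"
    by (simp add: t_def field_simps)
  ultimately show ?thesis by (simp add: mult.assoc)
qed

lemma zonal_1:
  assumes c: "m + 1 / 2 \<noteq> (0 :: complex)"
  shows "zonal m 1 x = x"
proof -
  have z: "pochhammer (- 1 :: complex) k = 0" if "k > 1" for k
    using that pochhammer_of_nat_eq_0_iff[of 1 k] by simp
  have "(\<lambda>k. fps_nth (gauss_fps (- of_nat 1) (of_nat 1 + 2 * m) (m + 1 / 2)) k * ((1 - x) / 2) ^ k) sums
     (\<Sum>k\<in>{0, 1}. fps_nth (gauss_fps (- of_nat 1) (of_nat 1 + 2 * m) (m + 1 / 2)) k * ((1 - x) / 2) ^ k)"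
    by (rule sums_finite) (auto simp: z)
  then have "zonal m 1 x = (\<Sum>k\<in>{0, 1}. fps_nth (gauss_fps (- of_nat 1) (of_nat 1 + 2 * m) (m + 1 / 2)) k * ((1 - x) / 2) ^ k)"
    unfolding zonal_def eval_fps_def by (simp add: sums_iff)
  also have "\<dots> = x"
  proof -
    have "fps_nth (gauss_fps (- of_nat 1) (of_nat 1 + 2 * m) (m + 1 / 2)) 1 = - ((2 * (m + 1 / 2)) / (m + 1 / 2))"
      by (simp add: minus_divide_left)
    also have "\<dots> = - 2" using c by (simp only: nonzero_mult_div_cancel_right not_False_eq_True)
    finally show ?thesis by (simp add: field_simps del: fps_hypergeo_nth)
  qed
  finally show ?thesis .
qed

lemma pochhammer_norm_nonneg: "0 \<le> pochhammer (norm a) k"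
  by (induction k) (auto simp: pochhammer_Suc)

lemma norm_pochhammer_le: "norm (pochhammer (a :: complex) k) \<le> pochhammer (norm a) k"
proof (induction k)
  case (Suc k)
  have "norm (a + of_nat k) \<le> norm a + of_nat k" by (metis norm_of_nat norm_triangle_ineq)
  then show ?case unfolding pochhammer_Suc norm_mult
    by (intro mult_mono Suc) (auto intro: pochhammer_norm_nonneg)
qed simp

text \<open>
  Writing \<open>x = (u + v) / 2\<close> with \<open>u v = 1\<close> and \<open>norm u = norm v = 1\<close>, the polynomial \<open>C_k(x)\<close> is the
  \<open>k\<close>-th coefficient of \<open>(1 - u X) powr (-m) * (1 - v X) powr (-m)\<close>, because the first-order
  equation of this product has the Gegenbauer recurrence as coefficient recurrence. Bounding
  the convolution termwise replaces \<open>m\<close> by \<open>norm m\<close> and \<open>u\<close>, \<open>v\<close> by 1, and Vandermonde's identity sums it.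
  The bound has to hold for negative \<open>m\<close> too, where \<open>C_k\<close> need not attain its maximum at 1.
\<close>

lemma norm_zonal_le:
  fixes m :: complex and x :: real
  assumes c: "\<And>n. m + 1 / 2 + of_nat n \<noteq> 0" and x: "x \<in> {-1..1}"
  shows "norm (pochhammer (2 * m) k / fact k * zonal m k (of_real x)) \<le> pochhammer (2 * norm m) k / fact k"
proof -
  define B where "B u = Abs_fps (\<lambda>j. pochhammer m j / fact j * u ^ j)" for u :: complex
  define u where "u = Complex x (sqrt (1 - x\<^sup>2))"
  define v where "v = Complex x (- sqrt (1 - x\<^sup>2))"
  have x2: "1 - x\<^sup>2 \<ge> 0" using x by (simp add: abs_square_le_1 abs_le_iff)
  have nu: "norm u = 1" "norm v = 1" using x2 by (simp_all add: u_def v_def cmod_def)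
  have uv: "u * v = 1" "u + v = 2 * of_real x"
    using x2 by (auto simp: u_def v_def complex_eq_iff power2_eq_square)
  have dB: "fps_deriv (B w) - fps_const w * (fps_X * fps_deriv (B w)) = fps_const (m * w) * B w" for w
  proof (rule fps_ext)
    fix n
    have p: "of_nat (Suc n) * (pochhammer m (Suc n) / fact (Suc n)) = (m + of_nat n) * (pochhammer m n / fact n)" for n
      by (simp add: pochhammer_Suc field_simps del: of_nat_Suc)
    have e: "of_nat (Suc n) * fps_nth (B w) (Suc n) = (m + of_nat n) * w * fps_nth (B w) n" for n
    proof -
      have "of_nat (Suc n) * fps_nth (B w) (Suc n) =
          of_nat (Suc n) * (pochhammer m (Suc n) / fact (Suc n)) * w ^ Suc n"
        by (simp only: B_def fps_nth_Abs_fps mult.assoc)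
      also have "\<dots> = (m + of_nat n) * w * fps_nth (B w) n"
        unfolding p by (simp add: B_def)
      finally show ?thesis .
    qed
    show "fps_nth (fps_deriv (B w) - fps_const w * (fps_X * fps_deriv (B w))) n = fps_nth (fps_const (m * w) * B w) n"
      using e[of n] by (cases n) (auto simp: algebra_simps)
  qed
  define P where "P = B u * B v"
  define s where "s = 2 * complex_of_real x"
  have "fps_deriv P - fps_const s * (fps_X * fps_deriv P) + fps_X * (fps_X * fps_deriv P)
     = fps_const (m * s) * P - fps_const (2 * m) * (fps_X * P)"
  proof -
    define U where "U = fps_const u"
    define V where "V = fps_const v"
    define M where "M = fps_const m"
    define X where "X = (fps_X :: complex fps)"
    have "U * V = 1" "fps_const s = U + V"
      using uv by (simp_all add: U_def V_def s_def)
    moreover have "fps_deriv (B u) - U * (X * fps_deriv (B u)) = M * U * B u"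
      "fps_deriv (B v) - V * (X * fps_deriv (B v)) = M * V * B v"
      using dB[of u] dB[of v] by (simp_all add: U_def V_def M_def X_def)
    moreover have "fps_const (m * s) = M * fps_const s" "fps_const (2 * m) = 2 * M"
      by (simp_all add: M_def fps_numeral_fps_const)
    moreover have "fps_deriv P = fps_deriv (B u) * B v + B u * fps_deriv (B v)"
      by (simp add: P_def algebra_simps)
    ultimately show ?thesis unfolding X_def[symmetric] P_def by algebra
  qed
  note ode = this
  have rec: "of_nat (Suc (Suc k)) * fps_nth P (Suc (Suc k))
      = (of_nat k + 1 + m) * s * fps_nth P (Suc k) - (of_nat k + 2 * m) * fps_nth P k" for k
    using arg_cong[OF ode, of "\<lambda>f. fps_nth f (Suc k)"] by (cases k) (auto simp: algebra_simps)
  have P0: "fps_nth P 0 = 1" by (simp add: P_def B_def)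
  have P1: "fps_nth P 1 = m * s" using arg_cong[OF ode, of "\<lambda>f. fps_nth f 0"] P0 by simp
  define Q where "Q k = pochhammer (2 * m) k / fact k * zonal m k (of_real x)" for k
  have "Q k = fps_nth P k \<and> Q (Suc k) = fps_nth P (Suc k)" for k
  proof (induction k)
    case 0
    then show ?case using P0 P1 zonal_1[of m "of_real x"] c[of 0] by (simp add: Q_def zonal_0 s_def)
  next
    case (Suc k)
    have z: "(of_nat k + 1 + 2 * m) * zonal m (Suc (Suc k)) (of_real x) =
       (of_nat k + 1 + m) * s * zonal m (Suc k) (of_real x) - (of_nat k + 1) * zonal m k (of_real x)"
      using zonal_recurrence[OF c, of k "of_real x"] by (simp add: s_def mult_ac)
    define p where "p = pochhammer (2 * m) k / fact k"
    have p1: "pochhammer (2 * m) (Suc k) / fact (Suc k) = p * (2 * m + of_nat k) / (of_nat k + 1)"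
      by (simp add: p_def pochhammer_Suc add.commute)
    have p2: "of_nat (Suc (Suc k)) * (pochhammer (2 * m) (Suc (Suc k)) / fact (Suc (Suc k))) =
        p * (2 * m + of_nat k) / (of_nat k + 1) * (of_nat k + 1 + 2 * m)"
    proof -
      have "of_nat (Suc (Suc k)) * (pochhammer (2 * m) (Suc (Suc k)) / fact (Suc (Suc k))) =
         pochhammer (2 * m) (Suc k) / fact (Suc k) * (of_nat k + 1 + 2 * m)"
        unfolding pochhammer_Suc[of _ "Suc k"] fact_Suc[of "Suc k"]
        by (simp add: divide_simps del: of_nat_Suc fact_Suc pochhammer_Suc) (simp add: algebra_simps)
      then show ?thesis unfolding p1 .
    qed
    have nz: "of_nat k + 1 \<noteq> (0 :: complex)" by (metis of_nat_Suc add.commute of_nat_neq_0)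
    have "of_nat (Suc (Suc k)) * Q (Suc (Suc k)) = p * (2 * m + of_nat k) / (of_nat k + 1) *
        ((of_nat k + 1 + 2 * m) * zonal m (Suc (Suc k)) (of_real x))"
      unfolding Q_def using p2 by (metis mult.assoc)
    also have "\<dots> = (of_nat k + 1 + m) * s * (p * (2 * m + of_nat k) / (of_nat k + 1) * zonal m (Suc k) (of_real x))
         - (of_nat k + 2 * m) * (p * zonal m k (of_real x))"
      unfolding z using nz by (simp add: divide_simps) (simp add: algebra_simps)
    also have "\<dots> = (of_nat k + 1 + m) * s * Q (Suc k) - (of_nat k + 2 * m) * Q k"
      unfolding Q_def p1 by (simp add: p_def)
    also have "\<dots> = of_nat (Suc (Suc k)) * fps_nth P (Suc (Suc k))"
      using Suc rec[of k] by simp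
    finally have "Q (Suc (Suc k)) = fps_nth P (Suc (Suc k))" by (simp del: of_nat_Suc)
    then show ?case using Suc by simp
  qed
  then have "Q k = fps_nth P k" by blast
  also have "norm \<dots> \<le> (\<Sum>j\<le>k. norm (fps_nth (B u) j * fps_nth (B v) (k - j)))"
    unfolding P_def fps_mult_nth atLeast0AtMost by (rule norm_sum)
  also have "\<dots> \<le> (\<Sum>j\<le>k. pochhammer (norm m) j / fact j * (pochhammer (norm m) (k - j) / fact (k - j)))"
    by (intro sum_mono) (auto simp: B_def norm_mult norm_divide norm_power nu
      intro!: mult_mono divide_right_mono norm_pochhammer_le divide_nonneg_nonneg pochhammer_norm_nonneg)
  also have "\<dots> = (\<Sum>j\<le>k. of_nat (k choose j) * pochhammer (norm m) j * pochhammer (norm m) (k - j)) / fact k"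
    unfolding sum_divide_distrib by (rule sum.cong) (auto simp: binomial_fact)
  also have "\<dots> = pochhammer (2 * norm m) k / fact k"
    using pochhammer_binomial_sum[of "norm m" "norm m" k] by simp
  finally show ?thesis unfolding Q_def .
qed

section \<open>Orthogonality\<close>

text \<open>
  A Beta integral after \<open>x = 2 t - 1\<close>, put in this form by the duplication formula.
\<close>

lemma ultraspherical_weight_has_integral:
  fixes \<mu> :: real
  assumes mu: "- 1 / 2 < \<mu>"
  shows "((\<lambda>x. (1 - x\<^sup>2) powr (\<mu> - 1 / 2)) has_integral
    sqrt pi * Gamma (\<mu> + 1 / 2) / Gamma (\<mu> + 1)) {-1..1}"
proof -
  define p where "p = \<mu> - 1 / 2"
  define B where "B = Beta (p + 1) (p + 1)"
  have p: "p + 1 > 0" using mu by (simp add: p_def)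
  have "((\<lambda>t. t powr p * (1 - t) powr p) has_integral B) (cbox 0 1)"
    using has_integral_Beta_real[OF p p] by (simp add: B_def)
  from has_integral_affinity'[OF this, of "1 / 2" "1 / 2"]
  have "((\<lambda>x. (x / 2 + 1 / 2) powr p * (1 - (x / 2 + 1 / 2)) powr p) has_integral 2 * B) {-1..1}"
    by (simp add: divide_simps)
  from has_integral_mult_right[OF this, of "4 powr p"]
  have "((\<lambda>x. 4 powr p * ((x / 2 + 1 / 2) powr p * (1 - (x / 2 + 1 / 2)) powr p)) has_integral 4 powr p * (2 * B)) {-1..1}" .
  then have I: "((\<lambda>x. (1 - x\<^sup>2) powr p) has_integral 4 powr p * (2 * B)) {-1..1}"
  proof (rule has_integral_eq[rotated])
    fix x :: real assume x: "x \<in> {-1..1}"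
    have "4 powr p * ((x / 2 + 1 / 2) powr p * (1 - (x / 2 + 1 / 2)) powr p)
        = (4 * ((x / 2 + 1 / 2) * (1 - (x / 2 + 1 / 2)))) powr p"
      using x by (simp add: powr_mult)
    also have "4 * ((x / 2 + 1 / 2) * (1 - (x / 2 + 1 / 2))) = 1 - x\<^sup>2"
      by (simp add: field_simps power2_eq_square)
    finally show "4 powr p * ((x / 2 + 1 / 2) powr p * (1 - (x / 2 + 1 / 2)) powr p) = (1 - x\<^sup>2) powr p" .
  qed
  define z where "z = \<mu> + 1 / 2"
  have z: "z > 0" using mu by (simp add: z_def)
  have "complex_of_real z \<notin> \<int>\<^sub>\<le>\<^sub>0" "complex_of_real z + 1 / 2 \<notin> \<int>\<^sub>\<le>\<^sub>0"
    using z by (auto simp: nonpos_Ints_def complex_eq_iff)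
  from Gamma_legendre_duplication[OF this]
  have "complex_of_real (Gamma z * Gamma (z + 1 / 2)) =
      complex_of_real (exp ((1 - 2 * z) * ln 2) * sqrt pi * Gamma (2 * z))"
    using Gamma_complex_of_real[of "z + 1 / 2"] Gamma_complex_of_real[of "2 * z"]
    by (simp add: Gamma_complex_of_real flip: exp_of_real)
  then have dup: "Gamma z * Gamma (z + 1 / 2) = exp ((1 - 2 * z) * ln 2) * sqrt pi * Gamma (2 * z)"
    by (simp only: of_real_eq_iff)
  have e: "exp ((1 - 2 * z) * ln 2) * (4 powr p * 2) = 1"
  proof -
    have "ln (4 :: real) = 2 * ln 2" using ln_realpow[of 2 2] by simp
    then have "exp ((1 - 2 * z) * ln 2) * (4 powr p * 2) = exp ((1 - 2 * z) * ln 2 + p * (2 * ln 2) + ln 2)"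
      by (simp add: powr_def exp_add)
    also have "(1 - 2 * z) * ln 2 + p * (2 * ln 2) + ln 2 = 0" by (simp add: z_def p_def algebra_simps)
    finally show ?thesis by simp
  qed
  have pos: "Gamma z > 0" "Gamma (z + 1 / 2) > 0" "Gamma (2 * z) > 0" using z by (auto intro: Gamma_real_pos)
  have "4 powr p * (2 * B) = (4 powr p * 2) * Gamma z * Gamma z / Gamma (2 * z)"
    by (simp add: B_def Beta_def p_def z_def add_ac)
  also have "\<dots> = (4 powr p * 2) * Gamma z * (exp ((1 - 2 * z) * ln 2) * sqrt pi * Gamma (2 * z) / Gamma (z + 1 / 2)) / Gamma (2 * z)"
    using pos unfolding dup[symmetric] by simp
  also have "\<dots> = (exp ((1 - 2 * z) * ln 2) * (4 powr p * 2)) * sqrt pi * Gamma z / Gamma (z + 1 / 2)"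
    using pos by simp
  also have "\<dots> = sqrt pi * Gamma (\<mu> + 1 / 2) / Gamma (\<mu> + 1)" unfolding e by (simp add: z_def add_ac)
  finally show ?thesis using I by (simp add: p_def)
qed

lemma add_half_nonzero:
  assumes "- 1 / 2 < \<mu>" shows "complex_of_real \<mu> + 1 / 2 + of_nat n \<noteq> 0"
proof
  assume "complex_of_real \<mu> + 1 / 2 + of_nat n = 0"
  then have "Re (complex_of_real \<mu> + 1 / 2 + of_nat n) = 0" by simp
  then show False using assms by simp
qed

lemma add_nat_double_nonzero:
  assumes "- 1 / 2 < \<mu>" "\<mu> \<noteq> 0" shows "2 * complex_of_real \<mu> + of_nat n \<noteq> 0"
proof
  assume "2 * complex_of_real \<mu> + of_nat n = 0"
  then have "Re (2 * complex_of_real \<mu> + of_nat n) = 0" by simp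
  then have "2 * \<mu> + real n = 0" by simp
  with assms show False by (cases n) auto
qed

text \<open>
  Sturm-Liouville argument: by \<open>ultraspherical_ode\<close> the integrand, multiplied by the difference
  \<open>d\<close> of the eigenvalues, is the derivative of the weighted Wronskian
  \<open>(1 - x\<^sup>2) powr (\<mu> + 1/2) * W\<close>, which is continuous up to the end points and vanishes there since
  \<open>\<mu> > -1/2\<close>. The weight itself may be unbounded there, so the fundamental theorem is used with
  differentiability in the interior only; it also supplies integrability.
\<close>

lemma zonal_orthogonal:
  fixes \<mu> :: real
  assumes mu: "- 1 / 2 < \<mu>" and kn: "k \<noteq> n"
  defines "m \<equiv> complex_of_real \<mu>"
  shows "((\<lambda>x. of_real ((1 - x\<^sup>2) powr (\<mu> - 1 / 2)) * (zonal m k (of_real x) * zonal m n (of_real x)))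
    has_integral 0) {-1..1}"
proof -
  note c = add_half_nonzero[OF mu, folded m_def]
  define z1 where "z1 j y = - eval_fps (fps_deriv (gauss_fps (- of_nat j) (of_nat j + 2 * m) (m + 1 / 2))) ((1 - y) / 2) / 2" for j y
  define z2 where "z2 j y = eval_fps (fps_deriv (fps_deriv (gauss_fps (- of_nat j) (of_nat j + 2 * m) (m + 1 / 2)))) ((1 - y) / 2) / 4" for j y
  have z: "(zonal m j has_field_derivative z1 j y) (at y)" "(z1 j has_field_derivative z2 j y) (at y)"
      "(1 - y\<^sup>2) * z2 j y - (2 * m + 1) * y * z1 j y + of_nat j * (of_nat j + 2 * m) * zonal m j y = 0" for j y
    using ultraspherical_ode[OF c, of "- of_nat j" "of_nat j + 2 * m" y]
    by (simp_all add: z1_def[abs_def] z2_def[abs_def] zonal_def[abs_def] fps_conv_radius_terminating del: minus_mult_minus)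
  define w where "w x = (1 - x\<^sup>2) powr (\<mu> - 1 / 2)" for x :: real
  define v where "v x = (1 - x\<^sup>2) powr (\<mu> + 1 / 2)" for x :: real
  define W where "W y = z1 k y * zonal m n y - zonal m k y * z1 n y" for y
  define W' where "W' y = z2 k y * zonal m n y - zonal m k y * z2 n y" for y
  define d where "d = of_nat n * (of_nat n + 2 * m) - of_nat k * (of_nat k + 2 * m)"
  have dW: "(W has_field_derivative W' y) (at y)" for y
    using DERIV_diff[OF DERIV_mult[OF z(2) z(1)] DERIV_mult[OF z(1) z(2)], where x = y]
    unfolding W_def[abs_def] W'_def by (rule DERIV_cong) (simp add: algebra_simps)
  have contv: "continuous_on {-1..1} v" unfolding v_def
    using mu by (intro continuous_on_powr' continuous_intros) (auto simp: abs_square_le_1)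
  have contW: "continuous_on UNIV W"
    by (rule continuous_at_imp_continuous_on) (use DERIV_isCont[OF dW] in blast)
  have contW': "continuous_on {-1..1} (\<lambda>x. W (complex_of_real x))"
    by (rule continuous_on_compose2[OF contW]) (auto intro: continuous_on_of_real continuous_on_id)
  have cont: "continuous_on {-1..1} (\<lambda>x. of_real (v x) * W (of_real x))"
    by (rule continuous_on_mult[OF continuous_on_of_real[OF contv] contW'])
  have "((\<lambda>x. of_real (v x) * W (of_real x)) has_vector_derivative
      d * (of_real (w x) * (zonal m k (of_real x) * zonal m n (of_real x)))) (at x)"
    if x: "x \<in> {-1<..<1}" for x
  proof -
    have x2: "1 - x\<^sup>2 > 0" using x by (simp add: abs_square_less_1 abs_less_iff)
    have "(v has_real_derivative - (2 * \<mu> + 1) * x * w x) (at x)"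
    proof -
      have "((\<lambda>x. 1 - x\<^sup>2) has_real_derivative - 2 * x) (at x)"
        by (auto intro!: derivative_eq_intros)
      from DERIV_chain2[OF has_real_derivative_powr[OF x2, of "\<mu> + 1 / 2"] this]
      show ?thesis unfolding v_def[abs_def] by (rule DERIV_cong) (simp add: w_def algebra_simps)
    qed
    then have dv: "((\<lambda>x. complex_of_real (v x)) has_vector_derivative of_real (- (2 * \<mu> + 1) * x * w x)) (at x)"
      by (rule has_vector_derivative_of_real)
    have "((\<lambda>x. of_real (v x) * W (of_real x)) has_vector_derivative
       of_real (v x) * W' (of_real x) + of_real (- (2 * \<mu> + 1) * x * w x) * W (of_real x)) (at x)"
      by (rule has_vector_derivative_mult[OF dv has_vector_derivative_real_field[OF dW]])
    moreover have "v x = w x * (1 - x\<^sup>2)"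
      using powr_mult_base[of "1 - x\<^sup>2" "\<mu> - 1 / 2"] x2 by (simp add: v_def w_def mult.commute add.commute)
    moreover have "of_real (w x * (1 - x\<^sup>2)) * W' (of_real x) + of_real (- (2 * \<mu> + 1) * x * w x) * W (of_real x)
        = d * (of_real (w x) * (zonal m k (of_real x) * zonal m n (of_real x)))"
    proof -
      define y where "y = complex_of_real x"
      define u where "u = complex_of_real (w x)"
      have "u * (1 - y\<^sup>2) * W' y - (2 * m + 1) * y * u * W y = d * (u * (zonal m k y * zonal m n y))"
        using z(3)[of y k] z(3)[of y n] unfolding W_def W'_def d_def by algebra
      moreover have "of_real (w x * (1 - x\<^sup>2)) = u * (1 - y\<^sup>2)" "of_real (- (2 * \<mu> + 1) * x * w x) = - ((2 * m + 1) * y * u)"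
        by (simp_all add: y_def u_def m_def algebra_simps)
      ultimately show ?thesis unfolding y_def[symmetric] u_def[symmetric] by simp
    qed
    ultimately show ?thesis by simp
  qed
  from fundamental_theorem_of_calculus_interior[OF _ cont this]
  have "((\<lambda>x. d * (of_real (w x) * (zonal m k (of_real x) * zonal m n (of_real x)))) has_integral 0) {-1..1}"
    by (simp add: v_def)
  from has_integral_mult_right[OF this, of "1 / d"]
  have "((\<lambda>x. 1 / d * (d * (of_real (w x) * (zonal m k (of_real x) * zonal m n (of_real x))))) has_integral 0) {-1..1}"
    by simp
  moreover have "d \<noteq> 0"
  proof
    assume "d = 0"
    moreover have "d = (of_nat n - of_nat k) * (of_nat n + of_nat k + 2 * m)" by (simp add: d_def algebra_simps)
    ultimately have "of_nat n + of_nat k + 2 * m = 0" using kn by simp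
    then have "Re (of_nat n + of_nat k + 2 * m) = 0" by simp
    then have "real n + real k + 2 * \<mu> = 0" by (simp add: m_def)
    moreover have "real n + real k \<ge> 1" using kn by linarith
    ultimately show False using mu by simp
  qed
  ultimately show ?thesis by (simp add: w_def)
qed

text \<open>
  Integrating the three-term recurrence against neighbouring polynomials expresses the integral of
  \<open>x c_n c_{n+1}\<close> (weight omitted) both through the norm of \<open>c_n\<close> and through that of \<open>c_{n+1}\<close>, so the norms follow
  from the integral of the weight.
\<close>

lemma zonal_norm:
  fixes \<mu> :: real
  assumes mu: "- 1 / 2 < \<mu>" "\<mu> \<noteq> 0"
  defines "m \<equiv> complex_of_real \<mu>"
  shows "((\<lambda>x. of_real ((1 - x\<^sup>2) powr (\<mu> - 1 / 2)) * (zonal m n (of_real x) * zonal m n (of_real x)))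
    has_integral of_real (sqrt pi * Gamma (\<mu> + 1 / 2) / Gamma (\<mu> + 1))
      * (fact n * m / (pochhammer (2 * m) n * (of_nat n + m)))) {-1..1}"
proof (induction n)
  case 0
  have "m \<noteq> 0" using mu by (simp add: m_def)
  then show ?case using has_integral_of_real[OF ultraspherical_weight_has_integral[OF mu(1)], where 'b = complex]
    by (simp add: zonal_0)
next
  case (Suc n)
  note c = add_half_nonzero[OF mu(1), folded m_def]
  note orth = zonal_orthogonal[OF mu(1), folded m_def]
  define w where "w x = complex_of_real ((1 - x\<^sup>2) powr (\<mu> - 1 / 2))" for x
  define z where "z j x = zonal m j (complex_of_real x)" for j x
  define h where "h = of_real (sqrt pi * Gamma (\<mu> + 1 / 2) / Gamma (\<mu> + 1))
      * (fact n * m / (pochhammer (2 * m) n * (of_nat n + m)))"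
  have nz: "of_nat n + 1 + m \<noteq> 0" "of_nat n + m \<noteq> 0" "of_nat n + 2 * m \<noteq> 0"
  proof -
    have "real n + 1 + \<mu> \<noteq> 0" "real n + \<mu> \<noteq> 0" "real n + 2 * \<mu> \<noteq> 0"
      using mu by (cases n; simp)+
    then have "complex_of_real (real n + 1 + \<mu>) \<noteq> 0" "complex_of_real (real n + \<mu>) \<noteq> 0"
      "complex_of_real (real n + 2 * \<mu>) \<noteq> 0" by (simp_all only: of_real_eq_0_iff not_False_eq_True)
    then show "of_nat n + 1 + m \<noteq> 0" "of_nat n + m \<noteq> 0" "of_nat n + 2 * m \<noteq> 0" by (simp_all add: m_def)
  qed
  have rec: "(of_nat j + 1 + 2 * m) * z (Suc (Suc j)) x =
      2 * (of_nat j + 1 + m) * of_real x * z (Suc j) x - (of_nat j + 1) * z j x" for j x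
    unfolding z_def by (rule zonal_recurrence[OF c])
  have Jx: "((\<lambda>x. of_real x * (w x * (z (Suc n) x * z n x))) has_integral (of_nat n + 1) / (2 * (of_nat n + 1 + m)) * h) {-1..1}"
  proof -
    have I1: "((\<lambda>x. w x * (z (Suc (Suc n)) x * z n x)) has_integral 0) {-1..1}"
      unfolding w_def z_def by (rule orth) simp
    have I2: "((\<lambda>x. w x * (z n x * z n x)) has_integral h) {-1..1}"
      using Suc unfolding w_def z_def h_def .
    have "((\<lambda>x. (of_nat n + 1 + 2 * m) / (2 * (of_nat n + 1 + m)) * (w x * (z (Suc (Suc n)) x * z n x))
       + (of_nat n + 1) / (2 * (of_nat n + 1 + m)) * (w x * (z n x * z n x))) has_integral
       (of_nat n + 1 + 2 * m) / (2 * (of_nat n + 1 + m)) * 0 + (of_nat n + 1) / (2 * (of_nat n + 1 + m)) * h) {-1..1}"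
      by (intro has_integral_add has_integral_mult_right I1 I2)
    moreover have "(of_nat n + 1 + 2 * m) / (2 * (of_nat n + 1 + m)) * (w x * (z (Suc (Suc n)) x * z n x))
       + (of_nat n + 1) / (2 * (of_nat n + 1 + m)) * (w x * (z n x * z n x)) = of_real x * (w x * (z (Suc n) x * z n x))" for x
    proof -
      define q where "q = 2 * (of_nat n + 1 + m)"
      have q: "q \<noteq> 0" unfolding q_def using nz(1) by (simp only: mult_eq_0_iff) simp
      have "(of_nat n + 1 + 2 * m) * (w x * (z (Suc (Suc n)) x * z n x)) + (of_nat n + 1) * (w x * (z n x * z n x))
          = q * (of_real x * (w x * (z (Suc n) x * z n x)))"
        using rec[of n x] unfolding q_def by algebra
      then show ?thesis using q unfolding q_def[symmetric]
        by (simp only: times_divide_eq_left add_divide_distrib[symmetric] nonzero_mult_div_cancel_left not_False_eq_True)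
    qed
    ultimately show ?thesis by simp
  qed
  have "((\<lambda>x. w x * (z (Suc n) x * z (Suc n) x)) has_integral
      2 * (of_nat n + m) / (of_nat n + 2 * m) * ((of_nat n + 1) / (2 * (of_nat n + 1 + m)) * h)) {-1..1}"
  proof (cases n)
    case 0
    have "m \<noteq> 0" using mu by (simp add: m_def)
    then show ?thesis using Jx zonal_1[of m] c[of 0] unfolding 0 by (simp add: z_def zonal_0 mult_ac)
  next
    case (Suc p)
    have I1: "((\<lambda>x. w x * (z p x * z (Suc n) x)) has_integral 0) {-1..1}"
      unfolding w_def z_def by (rule orth) (simp add: Suc)
    have "((\<lambda>x. 2 * (of_nat n + m) / (of_nat n + 2 * m) * (of_real x * (w x * (z (Suc n) x * z n x)))
       - of_nat n / (of_nat n + 2 * m) * (w x * (z p x * z (Suc n) x))) has_integral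
       2 * (of_nat n + m) / (of_nat n + 2 * m) * ((of_nat n + 1) / (2 * (of_nat n + 1 + m)) * h)
         - of_nat n / (of_nat n + 2 * m) * 0) {-1..1}"
      by (intro has_integral_diff has_integral_mult_right I1 Jx)
    moreover have "2 * (of_nat n + m) / (of_nat n + 2 * m) * (of_real x * (w x * (z (Suc n) x * z n x)))
       - of_nat n / (of_nat n + 2 * m) * (w x * (z p x * z (Suc n) x)) = w x * (z (Suc n) x * z (Suc n) x)" for x
    proof -
      define q where "q = of_nat n + 2 * m"
      have q: "q \<noteq> 0" using nz by (simp add: q_def)
      have "q * z (Suc n) x = 2 * (of_nat n + m) * of_real x * z n x - of_nat n * z p x"
        using rec[of p x] by (simp add: q_def Suc add_ac)
      then have "2 * (of_nat n + m) * (of_real x * (w x * (z (Suc n) x * z n x))) - of_nat n * (w x * (z p x * z (Suc n) x))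
          = q * (w x * (z (Suc n) x * z (Suc n) x))"
        by algebra
      then show ?thesis using q unfolding q_def[symmetric]
        by (simp only: times_divide_eq_left diff_divide_distrib[symmetric] nonzero_mult_div_cancel_left not_False_eq_True)
    qed
    ultimately show ?thesis by simp
  qed
  moreover have "2 * (of_nat n + m) / (of_nat n + 2 * m) * ((of_nat n + 1) / (2 * (of_nat n + 1 + m)) * h)
     = of_real (sqrt pi * Gamma (\<mu> + 1 / 2) / Gamma (\<mu> + 1))
      * (fact (Suc n) * m / (pochhammer (2 * m) (Suc n) * (of_nat (Suc n) + m)))"
  proof -
    define N where "N = of_nat n + (1 :: complex)"
    define a b q g where "a = of_nat n + m" and "b = of_nat n + 2 * m" and "q = N + m"
      and "g = complex_of_real (sqrt pi * Gamma (\<mu> + 1 / 2) / Gamma (\<mu> + 1))"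
    have e: "pochhammer (2 * m) (Suc n) = pochhammer (2 * m) n * b" "of_nat (Suc n) + m = q"
       "fact (Suc n) = N * (fact n :: complex)"
      by (simp_all add: pochhammer_Suc b_def q_def N_def add_ac)
    have "a \<noteq> 0" "b \<noteq> 0" "q \<noteq> 0" using nz by (simp_all add: a_def b_def q_def N_def)
    then show ?thesis unfolding h_def e unfolding a_def[symmetric] b_def[symmetric] g_def[symmetric] N_def[symmetric] unfolding q_def[symmetric]
      by (simp add: mult_ac)
  qed
  ultimately show ?case unfolding w_def z_def by (simp only:)
qed

section \<open>The generating function\<close>

text \<open>
  Write \<open>z\<close> for the variable of the series and \<open>\<theta> = z d/dz\<close>. Multiplied by \<open>z\<close>, the equation reads
  \<open>\<theta> (\<theta> + 2 m - 1) g = 2 X z (\<theta> + l) (\<theta> + m) g - z\<^sup>2 (\<theta> + l + 1) (\<theta> + l) g\<close>,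
  and \<open>\<theta>\<close> acts on \<open>z ^ k\<close> as multiplication by \<open>k\<close>.
\<close>

lemma generating_ode_recurrence:
  fixes g :: "complex fps" and X m l :: complex
  assumes "fps_X * (1 - fps_const (2 * X) * fps_X + fps_X * fps_X) * fps_deriv (fps_deriv g)
      + (fps_const (2 * m) - fps_const (2 * X * (1 + l + m)) * fps_X + fps_const (2 * l + 2) * (fps_X * fps_X)) * fps_deriv g
      + (fps_const (l * (l + 1)) * fps_X - fps_const (2 * X * l * m)) * g = 0"
  shows "m * fps_nth g 1 = X * l * m * fps_nth g 0"
    and "(of_nat k + 2) * (of_nat k + 1 + 2 * m) * fps_nth g (Suc (Suc k)) =
      (l + of_nat k + 1) * (2 * (of_nat k + 1 + m) * X * fps_nth g (Suc k) - (l + of_nat k) * fps_nth g k)"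
proof -
  define L where "L = fps_X * fps_deriv (fps_deriv g) - fps_const (2 * X) * (fps_X * (fps_X * fps_deriv (fps_deriv g)))
      + fps_X * (fps_X * (fps_X * fps_deriv (fps_deriv g)))
      + fps_const (2 * m) * fps_deriv g - fps_const (2 * X * (1 + l + m)) * (fps_X * fps_deriv g)
      + fps_const (2 * l + 2) * (fps_X * (fps_X * fps_deriv g))
      + fps_const (l * (l + 1)) * (fps_X * g) - fps_const (2 * X * l * m) * g"
  have L: "L = 0" using assms unfolding L_def by algebra
  have "fps_nth L 0 = 0" by (simp add: L)
  then show "m * fps_nth g 1 = X * l * m * fps_nth g 0" by (simp add: L_def)
  have "fps_nth L (Suc k) = 0" by (simp add: L)
  moreover have "fps_nth L (Suc k) = (of_nat k + 2) * (of_nat k + 1 + 2 * m) * fps_nth g (Suc (Suc k))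
     - (l + of_nat k + 1) * (2 * (of_nat k + 1 + m) * X * fps_nth g (Suc k) - (l + of_nat k) * fps_nth g k)"
    unfolding L_def by (cases k; cases "k - 1") (auto simp: algebra_simps)
  ultimately show "(of_nat k + 2) * (of_nat k + 1 + 2 * m) * fps_nth g (Suc (Suc k)) =
      (l + of_nat k + 1) * (2 * (of_nat k + 1 + m) * X * fps_nth g (Suc k) - (l + of_nat k) * fps_nth g k)"
    by simp
qed

lemma generating_coefficients_unique:
  fixes g :: "complex fps" and X m l :: complex
  assumes c: "\<And>n. m + 1 / 2 + of_nat n \<noteq> 0" and m: "\<And>n. 2 * m + of_nat n \<noteq> 0"
    and g0: "fps_nth g 0 = 1" and g1: "m * fps_nth g 1 = X * l * m * fps_nth g 0"
    and rec: "\<And>k. (of_nat k + 2) * (of_nat k + 1 + 2 * m) * fps_nth g (Suc (Suc k)) =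
      (l + of_nat k + 1) * (2 * (of_nat k + 1 + m) * X * fps_nth g (Suc k) - (l + of_nat k) * fps_nth g k)"
  shows "fps_nth g k = pochhammer l k / fact k * zonal m k X"
proof -
  define A where "A k = pochhammer l k / fact k * zonal m k X" for k
  have "fps_nth g k = A k \<and> fps_nth g (Suc k) = A (Suc k)" for k
  proof (induction k)
    case 0
    then show ?case using g0 g1 zonal_1[of m X] c[of 0] m[of 0] by (simp add: A_def zonal_0)
  next
    case (Suc k)
    define K where "K = (of_nat k :: complex)"
    have z: "(K + 1 + 2 * m) * zonal m (Suc (Suc k)) X =
       2 * (K + 1 + m) * X * zonal m (Suc k) X - (K + 1) * zonal m k X"
      using zonal_recurrence[OF c, of k X] by (simp add: K_def)
    define p where "p = pochhammer l k / fact k"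
    have nz: "K + 1 \<noteq> 0" "K + 2 \<noteq> 0" "K + 1 + 2 * m \<noteq> 0"
    proof -
      have "of_nat (Suc k) \<noteq> (0 :: complex)" "of_nat (Suc (Suc k)) \<noteq> (0 :: complex)" by (simp_all only: of_nat_eq_0_iff)
      then show "K + 1 \<noteq> 0" "K + 2 \<noteq> 0" by (simp_all add: K_def add_ac)
      show "K + 1 + 2 * m \<noteq> 0" using m[of "Suc k"] by (simp add: K_def add_ac)
    qed
    have f: "fact (Suc k) = (K + 1) * fact k" "fact (Suc (Suc k)) = (K + 2) * ((K + 1) * fact k)"
      by (simp_all add: K_def add_ac)
    have p1: "pochhammer l (Suc k) / fact (Suc k) = p * (l + K) / (K + 1)"
      unfolding f by (simp add: p_def pochhammer_Suc K_def)
    have p2: "pochhammer l (Suc (Suc k)) / fact (Suc (Suc k)) = p * (l + K) * (l + K + 1) / ((K + 1) * (K + 2))"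
      unfolding f by (simp add: p_def pochhammer_Suc K_def add_ac mult_ac)
    have "(K + 2) * (K + 1 + 2 * m) * A (Suc (Suc k)) =
        p * (l + K) * (l + K + 1) / (K + 1) * ((K + 1 + 2 * m) * zonal m (Suc (Suc k)) X)"
      unfolding A_def p2 using nz by (simp add: divide_simps)
    also have "\<dots> = (l + K + 1) * (2 * (K + 1 + m) * X * (p * (l + K) / (K + 1) * zonal m (Suc k) X) - (l + K) * (p * zonal m k X))"
      unfolding z using nz by (simp add: divide_simps) (simp add: algebra_simps)
    also have "\<dots> = (l + K + 1) * (2 * (K + 1 + m) * X * A (Suc k) - (l + K) * A k)"
      unfolding A_def p1 by (simp add: p_def)
    also have "\<dots> = (K + 2) * (K + 1 + 2 * m) * fps_nth g (Suc (Suc k))"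
      using rec[of k] Suc by (simp add: K_def)
    finally have "A (Suc (Suc k)) = fps_nth g (Suc (Suc k))"
      using nz by (simp only: mult_cancel_left mult_eq_0_iff) simp
    then show ?case using Suc by simp
  qed
  then show ?thesis unfolding A_def by blast
qed

text \<open>
  The majorant is chosen as a coefficient of another hypergeometric series, so that
  \<open>fps_conv_radius_gauss_fps\<close> provides convergence in the unit disc, uniformly in \<open>x\<close>.
\<close>

lemma generating_coefficient_bound:
  fixes m l :: complex and x :: real
  assumes c: "\<And>n. m + 1 / 2 + of_nat n \<noteq> 0" and m: "\<And>n. 2 * m + of_nat n \<noteq> 0" and x: "x \<in> {-1..1}"
  shows "norm (pochhammer l k / fact k * zonal m k (of_real x)) \<le>
    norm (fps_nth (gauss_fps l (of_real (2 * norm m)) (2 * m)) k)"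
proof -
  have p: "pochhammer (2 * m) k \<noteq> 0" using m by (auto simp: pochhammer_eq_0_iff) (metis add.left_inverse)
  have "norm (pochhammer l k / fact k * zonal m k (of_real x)) =
      norm (pochhammer l k / pochhammer (2 * m) k) * norm (pochhammer (2 * m) k / fact k * zonal m k (of_real x))"
    using p by (simp flip: norm_mult)
  also have "\<dots> \<le> norm (pochhammer l k / pochhammer (2 * m) k) * (pochhammer (2 * norm m) k / fact k)"
    by (intro mult_left_mono norm_zonal_le[OF c x]) simp_all
  also have "\<dots> = norm (fps_nth (gauss_fps l (of_real (2 * norm m)) (2 * m)) k)"
  proof -
    have "pochhammer (2 * norm m) k = norm (pochhammer (complex_of_real (2 * norm m)) k)"
      using pochhammer_norm_nonneg[of "of_real (2 * norm m) :: complex" k]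
      by (simp only: pochhammer_of_real norm_of_real) (simp add: norm_mult)
    then show ?thesis by (simp add: norm_mult norm_divide)
  qed
  finally show ?thesis .
qed


text \<open>
  For fixed \<open>x\<close> both sides are holomorphic in \<open>\<rho>\<close> on a domain containing \<open>[0, 1)\<close>. Near 0 they agree since
  they satisfy the same singular differential equation; the identity theorem does the rest.
\<close>

lemma gegenbauer_generating_function:
  fixes \<mu> x \<rho> :: real and l :: complex
  assumes mu: "- 1 / 2 < \<mu>" "\<mu> \<noteq> 0" and x: "x \<in> {-1..1}" and rho: "0 \<le> \<rho>" "\<rho> < 1"
  defines "m \<equiv> complex_of_real \<mu>" and "R \<equiv> sqrt (1 + \<rho>\<^sup>2 - 2 * \<rho> * x)"
  shows "(\<lambda>k. pochhammer l k / fact k * zonal m k (of_real x) * of_real \<rho> ^ k) sums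
    (of_real R powr (- l) * eval_fps (gauss_fps l (2 * m - l) (m + 1 / 2)) (of_real ((1 - (1 - \<rho> * x) / R) / 2)))"
proof -
  note c = add_half_nonzero[OF mu(1), folded m_def]
  note m2 = add_nat_double_nonzero[OF mu, folded m_def]
  define X where "X = complex_of_real x"
  define A where "A = Abs_fps (\<lambda>k. pochhammer l k / fact k * zonal m k X)"
  have rA: "fps_conv_radius A \<ge> 1"
    unfolding fps_conv_radius_def
  proof (rule conv_radius_geI_ex')
    fix r :: real assume r: "0 < r" "ereal r < 1"
    let ?g = "gauss_fps l (of_real (2 * norm m)) (2 * m)"
    have "ereal (norm (complex_of_real r)) < fps_conv_radius ?g"
      by (rule less_le_trans[OF _ fps_conv_radius_gauss_fps[OF m2]]) (use r in auto)
    then have sg: "summable (\<lambda>k. norm (fps_nth ?g k * of_real r ^ k))"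
      by (rule norm_summable_fps)
    show "summable (\<lambda>k. fps_nth A k * of_real r ^ k)"
    proof (rule summable_comparison_test'[OF sg])
      show "norm (fps_nth A k * of_real r ^ k) \<le> norm (fps_nth ?g k * of_real r ^ k)" for k
        unfolding norm_mult using generating_coefficient_bound[OF c m2 x, of l k]
        by (intro mult_right_mono) (simp_all add: A_def X_def del: fps_hypergeo_nth)
    qed
  qed
  define f where "f = gauss_fps l (2 * m - l) (m + 1 / 2)"
  have rf: "fps_conv_radius f \<ge> 1" unfolding f_def by (rule fps_conv_radius_gauss_fps[OF c])
  define h0 where "h0 y = eval_fps f ((1 - y) / 2)" for y
  define h1 where "h1 y = - eval_fps (fps_deriv f) ((1 - y) / 2) / 2" for y
  define h2 where "h2 y = eval_fps (fps_deriv (fps_deriv f)) ((1 - y) / 2) / 4" for y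
  have h: "(h0 has_field_derivative h1 y) (at y)" "(h1 has_field_derivative h2 y) (at y)"
      "(1 - y\<^sup>2) * h2 y - (2 * m + 1) * y * h1 y - l * (2 * m - l) * h0 y = 0"
    if "norm ((1 - y) / 2) < 1" for y
  proof -
    have "ereal (norm ((1 - y) / 2)) < fps_conv_radius f"
      by (rule less_le_trans[OF _ rf]) (use that in simp)
    from ultraspherical_ode[OF c, of l "2 * m - l" y] this
    show "(h0 has_field_derivative h1 y) (at y)" "(h1 has_field_derivative h2 y) (at y)"
      "(1 - y\<^sup>2) * h2 y - (2 * m + 1) * y * h1 y - l * (2 * m - l) * h0 y = 0"
      unfolding h0_def[abs_def] h1_def[abs_def] h2_def[abs_def] f_def by simp_all
  qed
  \<comment> \<open>Here \<open>Q = R\<^sup>2\<close>, \<open>K = R^(-2)\<close>, \<open>P = 1 / R\<close> and \<open>E = R powr (-l)\<close>, all defined through one logarithm. Their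
    derivatives are then polynomials in these quantities, so that the differential equation becomes
    an identity modulo \<open>K Q = 1\<close> and \<open>P P = K\<close>.\<close>
  define Q where "Q z = 1 - 2 * X * z + z * z" for z
  define K where "K z = inverse (Q z)" for z
  define P where "P z = exp (- (Ln (Q z) / 2))" for z
  define E where "E z = exp (- l / 2 * Ln (Q z))" for z
  define Y where "Y z = (1 - X * z) * P z" for z
  \<comment> \<open>\<open>S0\<close> makes the logarithm holomorphic, and \<open>S\<close> keeps the argument of the hypergeometric series in the unit disc.
    \<open>S\<close> need not be connected.\<close>
  define S0 where "S0 = {z. norm z < 1} \<inter> {z. 0 < Re (Q z)}"
  define S where "S = S0 \<inter> (\<lambda>z. norm ((1 - Y z) / 2)) -` {..<1}"
  have nonpos: "Q z \<notin> \<real>\<^sub>\<le>\<^sub>0" if "z \<in> S0" for z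
    using that by (auto simp: S0_def complex_nonpos_Reals_iff)
  have dQ: "(Q has_field_derivative 2 * (z - X)) (at z)" for z
    unfolding Q_def[abs_def] by (auto intro!: derivative_eq_intros simp: algebra_simps)
  have KQ: "K z * Q z = 1" "P z * P z = K z" if "z \<in> S0" for z
  proof -
    have nz: "Q z \<noteq> 0" using nonpos[OF that] by auto
    then show "K z * Q z = 1" by (simp add: K_def)
    have "P z * P z = exp (- Ln (Q z))" unfolding P_def by (simp flip: exp_add)
    then show "P z * P z = K z" using nz by (simp add: K_def exp_minus)
  qed
  have dL: "((\<lambda>z. Ln (Q z)) has_field_derivative 2 * (z - X) * K z) (at z)" if "z \<in> S0" for z
    using DERIV_chain2[OF has_field_derivative_Ln[OF nonpos[OF that]] dQ] by (simp add: K_def mult_ac)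
  have dK: "(K has_field_derivative - (2 * (z - X) * K z * K z)) (at z)" if "z \<in> S0" for z
  proof -
    have "Q z \<noteq> 0" using nonpos[OF that] by auto
    from DERIV_inverse'[OF dQ this] show ?thesis
      unfolding K_def[abs_def] by (rule DERIV_cong) (simp add: mult_ac)
  qed
  have dP: "(P has_field_derivative - ((z - X) * P z * K z)) (at z)" if "z \<in> S0" for z
    using DERIV_chain2[OF DERIV_exp DERIV_minus[OF DERIV_cdivide[OF dL[OF that], of 2]]]
    unfolding P_def[abs_def] by (rule DERIV_cong) (simp add: mult_ac)
  have dE: "(E has_field_derivative - (l * (z - X) * K z * E z)) (at z)" if "z \<in> S0" for z
    using DERIV_chain2[OF DERIV_exp DERIV_cmult[OF dL[OF that], of "- l / 2"]]
    unfolding E_def[abs_def] by (rule DERIV_cong) (simp add: mult_ac)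
  have dY: "(Y has_field_derivative - (z * (1 - X\<^sup>2) * K z * P z)) (at z)" if "z \<in> S0" for z
  proof -
    have "((\<lambda>z. 1 - X * z) has_field_derivative - X) (at z)"
      by (auto intro!: derivative_eq_intros)
    from DERIV_mult[OF this dP[OF that]] show ?thesis
      unfolding Y_def[abs_def]
    proof (rule DERIV_cong)
      show "- X * P z + - ((z - X) * P z * K z) * (1 - X * z) = - (z * (1 - X\<^sup>2) * K z * P z)"
        using KQ(1)[OF that] unfolding Q_def by algebra
    qed
  qed
  have "open S0"
    unfolding S0_def Q_def by (intro open_Int open_Collect_less continuous_intros)
  have contY: "continuous_on S0 Y"
    by (rule continuous_at_imp_continuous_on) (use DERIV_isCont[OF dY] in blast)
  have "open S"
    unfolding S_def using \<open>open S0\<close>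
    by (intro continuous_open_preimage continuous_intros contY) auto
  have SS: "z \<in> S0" "norm ((1 - Y z) / 2) < 1" if "z \<in> S" for z using that by (auto simp: S_def)
  define G0 where "G0 z = E z * h0 (Y z)" for z
  define G1 where "G1 z = E z * (- l * (z - X) * K z * h0 (Y z) - z * (1 - X\<^sup>2) * K z * P z * h1 (Y z))" for z
  define G2 where "G2 z = E z * ((- (l * K z) + (2 * l + l\<^sup>2) * (z - X)\<^sup>2 * (K z)\<^sup>2) * h0 (Y z)
      - (1 - X\<^sup>2) * K z * P z * (1 - (3 + 2 * l) * z * (z - X) * K z) * h1 (Y z)
      + z\<^sup>2 * (1 - X\<^sup>2)\<^sup>2 * (K z * P z)\<^sup>2 * h2 (Y z))" for z
  have dh0: "((\<lambda>z. h0 (Y z)) has_field_derivative h1 (Y z) * - (z * (1 - X\<^sup>2) * K z * P z)) (at z)"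
   and dh1: "((\<lambda>z. h1 (Y z)) has_field_derivative h2 (Y z) * - (z * (1 - X\<^sup>2) * K z * P z)) (at z)" if "z \<in> S" for z
    using DERIV_chain2[OF h(1) dY] DERIV_chain2[OF h(2) dY] SS[OF that] by blast+
  have dG0: "(G0 has_field_derivative G1 z) (at z)" if "z \<in> S" for z
    using DERIV_mult[OF dE[OF SS(1)[OF that]] dh0[OF that]]
    unfolding G0_def[abs_def] by (rule DERIV_cong) (simp add: G1_def algebra_simps)
  have dG1: "(G1 has_field_derivative G2 z) (at z)" if "z \<in> S" for z
  proof -
    note z = SS(1)[OF that]
    have i: "((\<lambda>z. - l * (z - X)) has_field_derivative - l) (at z)"
      "((\<lambda>z. z * (1 - X\<^sup>2)) has_field_derivative 1 - X\<^sup>2) (at z)"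
      by (auto intro!: derivative_eq_intros)
    have "((\<lambda>z. E z * (- l * (z - X) * K z * h0 (Y z) - z * (1 - X\<^sup>2) * K z * P z * h1 (Y z))) has_field_derivative
      - (l * (z - X) * K z * E z) * (- l * (z - X) * K z * h0 (Y z) - z * (1 - X\<^sup>2) * K z * P z * h1 (Y z))
      + (((- l * K z + - (2 * (z - X) * K z * K z) * (- l * (z - X))) * h0 (Y z)
           + h1 (Y z) * - (z * (1 - X\<^sup>2) * K z * P z) * (- l * (z - X) * K z))
       - ((((1 - X\<^sup>2) * K z + - (2 * (z - X) * K z * K z) * (z * (1 - X\<^sup>2))) * P z
            + - ((z - X) * P z * K z) * (z * (1 - X\<^sup>2) * K z)) * h1 (Y z)
           + h2 (Y z) * - (z * (1 - X\<^sup>2) * K z * P z) * (z * (1 - X\<^sup>2) * K z * P z))) * E z) (at z)"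
      by (intro DERIV_mult DERIV_diff dE dh0 dh1 dK dP i z that)
    then show ?thesis unfolding G1_def[abs_def]
      by (rule DERIV_cong) (unfold G2_def, algebra)
  qed
  have ode: "z * Q z * G2 z + (2 * m - 2 * X * (1 + l + m) * z + (2 * l + 2) * (z * z)) * G1 z
      + (l * (l + 1) * z - 2 * X * l * m) * G0 z = 0" if "z \<in> S" for z
  proof -
    define k p q e a0 a1 a2 t where "k = K z" and "p = P z" and "q = Q z" and "e = E z"
      and "a0 = h0 (Y z)" and "a1 = h1 (Y z)" and "a2 = h2 (Y z)" and "t = 1 - X\<^sup>2"
    have kq: "k * q = 1" and pk: "p * p = k"
      using KQ[OF SS(1)[OF that]] by (simp_all add: k_def q_def p_def)
    have q: "q = 1 - 2 * X * z + z * z" by (simp add: q_def Q_def)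
    have Yp: "Y z = (1 - X * z) * p" by (simp add: Y_def p_def)
    have hh: "(1 - ((1 - X * z) * p)\<^sup>2) * a2 - (2 * m + 1) * ((1 - X * z) * p) * a1 - l * (2 * m - l) * a0 = 0"
      using h(3)[OF SS(2)[OF that]] unfolding Yp[symmetric] a0_def a1_def a2_def .
    have "1 - ((1 - X * z) * p)\<^sup>2 = z\<^sup>2 * t * k"
      using kq pk unfolding q t_def by algebra
    then have a2: "z\<^sup>2 * t * k * a2 = (2 * m + 1) * ((1 - X * z) * p) * a1 + l * (2 * m - l) * a0"
      using hh by algebra
    have "z\<^sup>2 * t\<^sup>2 * (k * p)\<^sup>2 * a2 = t * k\<^sup>2 * (z\<^sup>2 * t * k * a2)"
      unfolding pk[symmetric] by (simp add: power2_eq_square mult_ac)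
    then have b2: "z\<^sup>2 * t\<^sup>2 * (k * p)\<^sup>2 * a2 = t * k\<^sup>2 * ((2 * m + 1) * ((1 - X * z) * p) * a1 + l * (2 * m - l) * a0)"
      unfolding a2 .
    \<comment> \<open>Since \<open>1 - Y\<^sup>2 = z\<^sup>2 t k\<close>, the equation of \<open>h\<close> eliminates \<open>h''\<close> without a division by \<open>z\<close>. The
      remaining coefficients of \<open>h\<close> and of \<open>h'\<close> vanish separately.\<close>
    have c0: "z * q * (- (l * k) + (2 * l + l\<^sup>2) * (z - X)\<^sup>2 * k\<^sup>2 + t * k\<^sup>2 * (l * (2 * m - l)))
       + (2 * m - 2 * X * (1 + l + m) * z + (2 * l + 2) * (z * z)) * (- l * (z - X) * k)
       + (l * (l + 1) * z - 2 * X * l * m) = 0"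
      using kq unfolding q t_def by algebra
    have c1: "z * q * (- t * k * p * (1 - (3 + 2 * l) * z * (z - X) * k) + t * k\<^sup>2 * ((2 * m + 1) * ((1 - X * z) * p)))
       + (2 * m - 2 * X * (1 + l + m) * z + (2 * l + 2) * (z * z)) * (- z * t * k * p) = 0"
      using kq unfolding q by algebra
    have "z * q * G2 z + (2 * m - 2 * X * (1 + l + m) * z + (2 * l + 2) * (z * z)) * G1 z
      + (l * (l + 1) * z - 2 * X * l * m) * G0 z
      = e * (a0 * (z * q * (- (l * k) + (2 * l + l\<^sup>2) * (z - X)\<^sup>2 * k\<^sup>2 + t * k\<^sup>2 * (l * (2 * m - l)))
       + (2 * m - 2 * X * (1 + l + m) * z + (2 * l + 2) * (z * z)) * (- l * (z - X) * k)
       + (l * (l + 1) * z - 2 * X * l * m))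
       + a1 * (z * q * (- t * k * p * (1 - (3 + 2 * l) * z * (z - X) * k) + t * k\<^sup>2 * ((2 * m + 1) * ((1 - X * z) * p)))
       + (2 * m - 2 * X * (1 + l + m) * z + (2 * l + 2) * (z * z)) * (- z * t * k * p)))"
      unfolding G0_def G1_def G2_def k_def[symmetric] p_def[symmetric] e_def[symmetric]
        a0_def[symmetric] a1_def[symmetric] a2_def[symmetric] t_def[symmetric] b2
      by algebra
    then show ?thesis unfolding c0 c1 by (simp add: q_def)
  qed
  have segment: "of_real t \<in> S \<and> E (of_real t) = of_real (sqrt (1 + t\<^sup>2 - 2 * t * x)) powr (- l)
      \<and> Y (of_real t) = of_real ((1 - t * x) / sqrt (1 + t\<^sup>2 - 2 * t * x))" if t: "0 \<le> t" "t < 1" for t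
  proof -
    define q where "q = 1 + t\<^sup>2 - 2 * t * x"
    have tx: "t * x \<le> t" "t * x \<ge> - t" using x t mult_left_mono[of x 1 t] mult_left_mono[of "-1" x t] by auto
    have "(1 - t)\<^sup>2 > 0" using t by simp
    then have q: "q > 0" using tx by (simp add: q_def power2_eq_square algebra_simps)
    have Qt: "Q (of_real t) = of_real q" by (simp add: Q_def q_def X_def power2_eq_square)
    have LnQ: "Ln (Q (of_real t)) = of_real (ln q)" using q by (simp add: Qt Ln_of_real)
    have "P (of_real t) = of_real (exp (- (ln q / 2)))" unfolding P_def LnQ by (simp flip: exp_of_real)
    also have "exp (- (ln q / 2)) = 1 / sqrt q"
      using q by (simp add: exp_minus ln_sqrt[symmetric] inverse_eq_divide)
    finally have Yt: "Y (of_real t) = of_real ((1 - t * x) / sqrt q)" by (simp add: Y_def X_def mult.commute)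
    have Et: "E (of_real t) = of_real (sqrt q) powr (- l)"
      unfolding E_def LnQ using q by (simp add: powr_def Ln_of_real ln_sqrt)
    have y: "0 \<le> (1 - t * x) / sqrt q" "(1 - t * x) / sqrt q \<le> 1"
    proof -
      have "1 - t * x \<ge> 0" using tx t by linarith
      then show "0 \<le> (1 - t * x) / sqrt q" using q by simp
      have "t\<^sup>2 * x\<^sup>2 \<le> t\<^sup>2 * 1" using x by (intro mult_left_mono) (auto simp: abs_square_le_1 abs_le_iff)
      then have "(1 - t * x)\<^sup>2 \<le> q" by (simp add: q_def power2_eq_square algebra_simps)
      then have "1 - t * x \<le> sqrt q" by (rule real_le_rsqrt)
      then show "(1 - t * x) / sqrt q \<le> 1" using q by simp
    qed
    have "norm ((1 - Y (of_real t)) / 2) < 1"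
    proof -
      have "(1 - Y (of_real t)) / 2 = of_real ((1 - (1 - t * x) / sqrt q) / 2)" unfolding Yt by simp
      then show ?thesis using y by (simp only: norm_of_real) simp
    qed
    then have "of_real t \<in> S" using t q by (simp add: S_def S0_def Qt)
    then show ?thesis using Et Yt by (simp add: q_def)
  qed
  have "0 \<in> S" using segment[of 0] by simp
  have holG: "G0 holomorphic_on S"
    unfolding holomorphic_on_open[OF \<open>open S\<close>] using dG0 by blast
  define g where "g = fps_expansion G0 0"
  have e0: "G0 has_fps_expansion g"
    unfolding g_def by (rule has_fps_expansion_fps_expansion[OF \<open>open S\<close> \<open>0 \<in> S\<close> holG])
  have nearS: "\<forall>\<^sub>F z in nhds 0. z \<in> S"
    by (rule eventually_nhds_in_open[OF \<open>open S\<close> \<open>0 \<in> S\<close>])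
  have "G1 has_fps_expansion fps_deriv g"
  proof -
    have "\<forall>\<^sub>F z in nhds 0. deriv G0 z = G1 z"
      using nearS by eventually_elim (rule DERIV_imp_deriv[OF dG0])
    then show ?thesis using has_fps_expansion_deriv[OF e0] has_fps_expansion_cong by blast
  qed
  note e1 = this
  have "G2 has_fps_expansion fps_deriv (fps_deriv g)"
  proof -
    have "\<forall>\<^sub>F z in nhds 0. deriv G1 z = G2 z"
      using nearS by eventually_elim (rule DERIV_imp_deriv[OF dG1])
    then show ?thesis using has_fps_expansion_deriv[OF e1] has_fps_expansion_cong by blast
  qed
  note e2 = this
  have "(\<lambda>z. z * Q z * G2 z + (2 * m - 2 * X * (1 + l + m) * z + (2 * l + 2) * (z * z)) * G1 z
      + (l * (l + 1) * z - 2 * X * l * m) * G0 z) has_fps_expansion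
     fps_X * (1 - fps_const (2 * X) * fps_X + fps_X * fps_X) * fps_deriv (fps_deriv g)
      + (fps_const (2 * m) - fps_const (2 * X * (1 + l + m)) * fps_X + fps_const (2 * l + 2) * (fps_X * fps_X)) * fps_deriv g
      + (fps_const (l * (l + 1)) * fps_X - fps_const (2 * X * l * m)) * g"
    unfolding Q_def by (intro fps_expansion_intros e0 e1 e2)
  moreover have "(\<lambda>z. z * Q z * G2 z + (2 * m - 2 * X * (1 + l + m) * z + (2 * l + 2) * (z * z)) * G1 z
      + (l * (l + 1) * z - 2 * X * l * m) * G0 z) has_fps_expansion 0"
    unfolding has_fps_expansion_0_iff using nearS by eventually_elim (rule ode)
  ultimately have gode: "fps_X * (1 - fps_const (2 * X) * fps_X + fps_X * fps_X) * fps_deriv (fps_deriv g)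
      + (fps_const (2 * m) - fps_const (2 * X * (1 + l + m)) * fps_X + fps_const (2 * l + 2) * (fps_X * fps_X)) * fps_deriv g
      + (fps_const (l * (l + 1)) * fps_X - fps_const (2 * X * l * m)) * g = 0"
    by (rule fps_expansion_unique_complex)
  have "G0 0 = 1"
    using segment[of 0] by (simp add: G0_def h0_def f_def eval_fps_at_0 del: fps_hypergeo_nth)
  then have g0: "fps_nth g 0 = 1" using fps_nth_fps_expansion[OF e0, of 0] by simp
  have "g = A"
    unfolding A_def
    by (rule fps_ext) (simp add: generating_coefficients_unique[OF c m2 g0 generating_ode_recurrence[OF gode]])
  have "\<forall>\<^sub>F z in nhds 0. z \<in> S \<and> eval_fps A z = G0 z"
    using e0 nearS unfolding has_fps_expansion_def \<open>g = A\<close> by (auto elim: eventually_elim2)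
  then obtain r where r: "r > 0" "\<And>z. z \<in> ball 0 r \<Longrightarrow> z \<in> S \<and> eval_fps A z = G0 z"
    by (auto simp: eventually_nhds_metric dist_commute)
  define C where "C = connected_component_set S 0"
  have "G0 (of_real \<rho>) = eval_fps A (of_real \<rho>)"
  proof (rule analytic_continuation_open[where f = G0 and g = "eval_fps A" and s = "ball 0 r" and s' = C])
    show "open C" "connected C" unfolding C_def using \<open>open S\<close> by (auto intro: open_connected_component)
    have "C \<subseteq> S" unfolding C_def by (rule connected_component_subset)
    then show "G0 holomorphic_on C" using holG holomorphic_on_subset by blast
    have "C \<subseteq> ball 0 1" using \<open>C \<subseteq> S\<close> by (auto simp: S_def S0_def)
    moreover have "ball 0 1 \<subseteq> eball 0 (fps_conv_radius A)" using rA by (intro ball_eball_mono) (simp add: one_ereal_def)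
    ultimately show "eval_fps A holomorphic_on C" by (intro holomorphic_on_eval_fps) auto
    show "ball 0 r \<subseteq> C" unfolding C_def using r
      by (intro connected_component_maximal) auto
    have "complex_of_real ` {0..\<rho>} \<subseteq> C" unfolding C_def
    proof (rule connected_component_maximal)
      show "0 \<in> complex_of_real ` {0..\<rho>}" using rho by (auto intro: image_eqI[of _ _ 0])
      show "connected (complex_of_real ` {0..\<rho>})"
        by (intro connected_continuous_image continuous_intros) auto
      show "complex_of_real ` {0..\<rho>} \<subseteq> S" using segment rho by auto
    qed
    then show "of_real \<rho> \<in> C" using rho by auto
  qed (use r in auto)
  moreover have "(\<lambda>k. fps_nth A k * of_real \<rho> ^ k) sums eval_fps A (of_real \<rho>)"
    by (rule sums_eval_fps, rule less_le_trans[OF _ rA]) (use rho in simp)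
  ultimately show ?thesis
    using segment[OF rho] by (simp add: A_def X_def G0_def h0_def f_def R_def)
qed

section \<open>Projection onto a Gegenbauer polynomial\<close>

lemma generating_function_projection:
  fixes \<mu> \<rho> :: real and l :: complex
  assumes mu: "- 1 / 2 < \<mu>" "\<mu> \<noteq> 0" and rho: "0 \<le> \<rho>" "\<rho> < 1"
  defines "m \<equiv> complex_of_real \<mu>"
  shows "((\<lambda>x. of_real ((1 - x\<^sup>2) powr (\<mu> - 1 / 2)) *
      (of_real (sqrt (1 + \<rho>\<^sup>2 - 2 * \<rho> * x)) powr (- l) *
        eval_fps (gauss_fps l (2 * m - l) (m + 1 / 2)) (of_real ((1 - (1 - \<rho> * x) / sqrt (1 + \<rho>\<^sup>2 - 2 * \<rho> * x)) / 2)))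
      * zonal m n (of_real x)) has_integral
     pochhammer l n / fact n * of_real \<rho> ^ n * (of_real (sqrt pi * Gamma (\<mu> + 1 / 2) / Gamma (\<mu> + 1))
      * (fact n * m / (pochhammer (2 * m) n * (of_nat n + m))))) {-1..1}"
proof -
  note c = add_half_nonzero[OF mu(1), folded m_def]
  note m2 = add_nat_double_nonzero[OF mu, folded m_def]
  define w where "w x = (1 - x\<^sup>2) powr (\<mu> - 1 / 2)" for x :: real
  define z where "z k x = zonal m k (complex_of_real x)" for k x
  define a where "a k = pochhammer l k / fact k" for k
  define H where "H = of_real (sqrt pi * Gamma (\<mu> + 1 / 2) / Gamma (\<mu> + 1))
      * (fact n * m / (pochhammer (2 * m) n * (of_nat n + m)))"
  define T where "T x = of_real (sqrt (1 + \<rho>\<^sup>2 - 2 * \<rho> * x)) powr (- l) *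
        eval_fps (gauss_fps l (2 * m - l) (m + 1 / 2)) (of_real ((1 - (1 - \<rho> * x) / sqrt (1 + \<rho>\<^sup>2 - 2 * \<rho> * x)) / 2))" for x
  have T: "(\<lambda>k. a k * z k x * of_real \<rho> ^ k) sums T x" if "x \<in> {-1..1}" for x
    using gegenbauer_generating_function[OF mu that rho, of l] by (simp add: a_def z_def T_def m_def)
  define b where "b k = norm (fps_nth (gauss_fps l (of_real (2 * norm m)) (2 * m)) k * of_real \<rho> ^ k)" for k
  have sb: "summable b"
    unfolding b_def
    by (rule norm_summable_fps, rule less_le_trans[OF _ fps_conv_radius_gauss_fps[OF m2]]) (use rho in simp)
  have az: "norm (a k * z k x * of_real \<rho> ^ k) \<le> b k" if "x \<in> {-1..1}" for k x
    unfolding a_def z_def b_def norm_mult[of _ "of_real \<rho> ^ k"]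
    by (intro mult_right_mono generating_coefficient_bound[OF c m2 that]) simp
  define B where "B = pochhammer (2 * norm m) n / fact n / norm (pochhammer (2 * m) n / fact n)"
  have zB: "norm (z n x) \<le> B" if "x \<in> {-1..1}" for x
  proof -
    have "pochhammer (2 * m) n \<noteq> 0" using m2 by (auto simp: pochhammer_eq_0_iff) (metis add.left_inverse)
    then have "0 < norm (pochhammer (2 * m) n / fact n)" by simp
    then show ?thesis using norm_zonal_le[OF c that, of n]
      unfolding norm_mult B_def z_def by (simp only: pos_le_divide_eq mult.commute)
  qed
  define F where "F N x = of_real (w x) * (\<Sum>k<N. a k * z k x * of_real \<rho> ^ k) * z n x" for N x
  have "((\<lambda>x. of_real (w x) * T x * z n x) has_integral a n * of_real \<rho> ^ n * H) {-1..1}"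
  \<comment> \<open>By orthogonality the integrals of the partial sums are constant as soon as they contain the term \<open>k = n\<close>.\<close>
  proof (rule has_integral_dominated_convergence[where f = F
      and y = "\<lambda>N. if n < N then a n * of_real \<rho> ^ n * H else 0" and h = "\<lambda>x. w x * (suminf b * B)"])
    fix N
    have I: "((\<lambda>x. a k * of_real \<rho> ^ k * (of_real (w x) * (z k x * z n x))) has_integral
        (if k = n then a n * of_real \<rho> ^ n * H else 0)) {-1..1}" for k
    proof (cases "k = n")
      case True
      have "((\<lambda>x. of_real (w x) * (z n x * z n x)) has_integral H) {-1..1}"
        unfolding w_def z_def H_def m_def by (rule zonal_norm[OF mu])
      from has_integral_mult_right[OF this] True show ?thesis by simp
    next
      case False
      have "((\<lambda>x. of_real (w x) * (z k x * z n x)) has_integral 0) {-1..1}"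
        unfolding w_def z_def m_def by (rule zonal_orthogonal[OF mu(1) False])
      from has_integral_mult_right[OF this, of "a k * of_real \<rho> ^ k"] False show ?thesis by simp
    qed
    have "((\<lambda>x. \<Sum>k<N. a k * of_real \<rho> ^ k * (of_real (w x) * (z k x * z n x))) has_integral
      (\<Sum>k<N. if k = n then a n * of_real \<rho> ^ n * H else 0)) {-1..1}"
      by (intro has_integral_sum I) simp
    moreover have "(\<Sum>k<N. a k * of_real \<rho> ^ k * (of_real (w x) * (z k x * z n x))) = F N x" for x
      unfolding F_def sum_distrib_left sum_distrib_right by (intro sum.cong refl) (simp add: mult_ac)
    ultimately show "(F N has_integral (if n < N then a n * of_real \<rho> ^ n * H else 0)) {-1..1}"
      by simp
    show "\<forall>x\<in>{-1..1}. norm (F N x) \<le> w x * (suminf b * B)"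
    proof
      fix x :: real assume x: "x \<in> {-1..1}"
      have b0: "b k \<ge> 0" for k by (simp add: b_def)
      have "norm (\<Sum>k<N. a k * z k x * of_real \<rho> ^ k) \<le> (\<Sum>k<N. b k)"
        by (rule sum_norm_le) (rule az[OF x])
      also have "\<dots> \<le> suminf b" using sb b0 by (intro sum_le_suminf) auto
      finally have "norm (\<Sum>k<N. a k * z k x * of_real \<rho> ^ k) * norm (z n x) \<le> suminf b * B"
        using suminf_nonneg[OF sb b0] by (intro mult_mono zB[OF x]) auto
      then have "w x * (norm (\<Sum>k<N. a k * z k x * of_real \<rho> ^ k) * norm (z n x)) \<le> w x * (suminf b * B)"
        by (rule mult_left_mono) (simp add: w_def)
      moreover have "norm (F N x) = w x * (norm (\<Sum>k<N. a k * z k x * of_real \<rho> ^ k) * norm (z n x))"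
        by (simp add: F_def norm_mult w_def)
      ultimately show "norm (F N x) \<le> w x * (suminf b * B)" by simp
    qed
  next
    have "w integrable_on {-1..1}"
      unfolding w_def using ultraspherical_weight_has_integral[OF mu(1)] by blast
    then show "(\<lambda>x. w x * (suminf b * B)) integrable_on {-1..1}"
      by (rule integrable_on_mult_left)
    show "\<forall>x\<in>{-1..1}. (\<lambda>N. F N x) \<longlonglongrightarrow> of_real (w x) * T x * z n x"
      unfolding F_def using T by (intro ballI tendsto_intros) (simp add: sums_def)
    show "(\<lambda>N. if n < N then a n * of_real \<rho> ^ n * H else 0) \<longlonglongrightarrow> a n * of_real \<rho> ^ n * H"
      by (rule tendsto_eventually) (use eventually_gt_at_top[of n] in eventually_elim, simp)
  qed
  then show ?thesis unfolding w_def T_def z_def a_def H_def .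
qed

text \<open>
  Euler's transformation exchanges the parameters given by the definition of the Ferrers function
  for those of the generating function, \<open>c - a = 2 m - lam\<close> and \<open>c - b = lam\<close>.
\<close>

lemma ferrers_P_conv_gauss_fps:
  fixes \<mu> y :: real and lam :: complex
  assumes mu: "- 1 / 2 < \<mu>" and y: "0 \<le> y" "y < 1"
  defines "m \<equiv> complex_of_real \<mu>"
  shows "ferrers_P (m - lam - 1 / 2) (1 / 2 - m) y =
    of_real (((1 + y) / (1 - y)) powr (1 / 4 - \<mu> / 2) * ((1 + y) / 2) powr (\<mu> - 1 / 2) / Gamma (\<mu> + 1 / 2))
     * eval_fps (gauss_fps lam (2 * m - lam) (m + 1 / 2)) (of_real ((1 - y) / 2))"
proof -
  note c = add_half_nonzero[OF mu, folded m_def]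
  define t where "t = (1 - y) / 2"
  have t: "norm (complex_of_real t) < 1" using y unfolding norm_of_real by (simp add: t_def)
  have "hyp2F1 (- (m - lam - 1 / 2)) (m - lam - 1 / 2 + 1) (1 - (1 / 2 - m)) (of_real t)
     = hyp2F1 (lam + 1 / 2 - m) (m - lam + 1 / 2) (m + 1 / 2) (of_real t)"
    by (rule arg_cong3[where f = "\<lambda>a b c. hyp2F1 a b c (of_real t)"]) (simp_all add: algebra_simps)
  also have "\<dots> = eval_fps (gauss_fps (lam + 1 / 2 - m) (m - lam + 1 / 2) (m + 1 / 2)) (of_real t)"
    by (rule hyp2F1_eq_eval_fps[OF c t])
  also have "\<dots> = (1 - of_real t) powr (m + 1 / 2 - (lam + 1 / 2 - m) - (m - lam + 1 / 2))
      * eval_fps (gauss_fps (m + 1 / 2 - (lam + 1 / 2 - m)) (m + 1 / 2 - (m - lam + 1 / 2)) (m + 1 / 2)) (of_real t)"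
    by (rule Euler_transformation[OF c t])
  also have "m + 1 / 2 - (lam + 1 / 2 - m) - (m - lam + 1 / 2) = of_real (\<mu> - 1 / 2)" by (simp add: m_def)
  also have "m + 1 / 2 - (lam + 1 / 2 - m) = 2 * m - lam" by simp
  also have "m + 1 / 2 - (m - lam + 1 / 2) = lam" by simp
  also have "gauss_fps (2 * m - lam) lam (m + 1 / 2) = gauss_fps lam (2 * m - lam) (m + 1 / 2)"
    by (rule fps_ext) (simp add: mult_ac)
  also have "1 - complex_of_real t = of_real ((1 + y) / 2)" by (simp add: t_def field_simps)
  also have "of_real ((1 + y) / 2) powr of_real (\<mu> - 1 / 2) = complex_of_real (((1 + y) / 2) powr (\<mu> - 1 / 2))"
    using y by (intro powr_of_real) auto
  finally have F: "hyp2F1 (- (m - lam - 1 / 2)) (m - lam - 1 / 2 + 1) (1 - (1 / 2 - m)) (of_real t) =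
     of_real (((1 + y) / 2) powr (\<mu> - 1 / 2)) * eval_fps (gauss_fps lam (2 * m - lam) (m + 1 / 2)) (of_real t)" .
  have G: "Gamma (1 - (1 / 2 - m)) = of_real (Gamma (\<mu> + 1 / 2))"
    using Gamma_complex_of_real[of "\<mu> + 1 / 2"] by (simp add: m_def add_ac)
  have "(1 / 2 - m) / 2 = of_real (1 / 4 - \<mu> / 2)" by (simp add: m_def field_simps)
  then have p: "complex_of_real ((1 + y) / (1 - y)) powr ((1 / 2 - m) / 2) = of_real (((1 + y) / (1 - y)) powr (1 / 4 - \<mu> / 2))"
    using y by (simp only:, intro powr_of_real) auto
  show ?thesis
    unfolding ferrers_P_def F[unfolded t_def] G p t_def by simp
qed

text \<open>
  With \<open>e = \<mu> / 2 - 1/4\<close> everything on the left is an \<open>e\<close>-th power, and the bases multiply to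
  \<open>(1 - x\<^sup>2) R\<^sup>2 (1 - y\<^sup>2) / 4 = (\<rho> (1 - x\<^sup>2) / 2)\<^sup>2\<close>.
\<close>

lemma weight_simplification:
  fixes \<mu> \<rho> x :: real
  assumes rho: "0 < \<rho>" "\<rho> < 1" and x: "-1 < x" "x < 1"
  defines "R \<equiv> sqrt (1 + \<rho>\<^sup>2 - 2 * \<rho> * x)"
  defines "y \<equiv> (1 - \<rho> * x) / R"
  shows "0 < R" "0 \<le> y" "y < 1"
    and "(1 - x\<^sup>2) powr (\<mu> / 2 - 1 / 4) * R powr (\<mu> - 1 / 2) * (((1 + y) / (1 - y)) powr (1 / 4 - \<mu> / 2)
        * ((1 + y) / 2) powr (\<mu> - 1 / 2)) =
      \<rho> powr (\<mu> - 1 / 2) * 2 powr (1 / 2 - \<mu>) * (1 - x\<^sup>2) powr (\<mu> - 1 / 2)"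
proof -
  define q where "q = 1 + \<rho>\<^sup>2 - 2 * \<rho> * x"
  have x2: "x\<^sup>2 < 1" using x by (simp add: abs_square_less_1 abs_less_iff)
  have "\<rho> * x < \<rho>" using rho x by simp
  moreover have "(1 - \<rho>)\<^sup>2 > 0" using rho by simp
  ultimately have q: "q > 0" by (simp add: q_def power2_eq_square algebra_simps)
  then show R: "0 < R" by (simp add: R_def q_def)
  have R2: "R\<^sup>2 = q" using q by (simp add: R_def q_def)
  have id: "q - (1 - \<rho> * x)\<^sup>2 = \<rho>\<^sup>2 * (1 - x\<^sup>2)" by (simp add: q_def power2_eq_square algebra_simps)
  have rx: "1 - \<rho> * x > 0" using \<open>\<rho> * x < \<rho>\<close> rho by linarith
  then show y0: "0 \<le> y" using R by (simp add: y_def)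
  have yR: "y * R = 1 - \<rho> * x" using R by (simp add: y_def)
  have "(1 - \<rho> * x)\<^sup>2 < R\<^sup>2" using id R2 rho x2 by (smt (verit) mult_pos_pos zero_less_power)
  then have "1 - \<rho> * x < R" using R by (meson less_imp_le power_less_imp_less_base)
  then show y1: "y < 1" using R by (simp add: y_def)
  define e where "e = \<mu> / 2 - 1 / 4"
  have dbl: "a powr (2 * e) = (a\<^sup>2) powr e" if "a > 0" for a :: real
    using that by (simp add: powr_powr flip: powr_numeral)
  have neg: "((1 + y) / (1 - y)) powr (- e) = ((1 - y) / (1 + y)) powr e"
    using y0 y1 by (simp add: powr_minus_divide powr_divide)
  have "(1 - x\<^sup>2) powr e * R powr (2 * e) * (((1 + y) / (1 - y)) powr (- e) * ((1 + y) / 2) powr (2 * e))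
     = ((1 - x\<^sup>2) * R\<^sup>2 * ((1 - y) / (1 + y) * ((1 + y) / 2)\<^sup>2)) powr e"
  proof -
    have "(1 + y) / 2 > 0" using y0 by simp
    then show ?thesis unfolding neg dbl[OF R] powr_mult by (simp only: dbl mult.assoc)
  qed
  also have "(1 - x\<^sup>2) * R\<^sup>2 * ((1 - y) / (1 + y) * ((1 + y) / 2)\<^sup>2) = (\<rho> * (1 / 2) * (1 - x\<^sup>2))\<^sup>2"
  proof -
    have "(1 - y) / (1 + y) * ((1 + y) / 2)\<^sup>2 = (1 - y\<^sup>2) / 4"
      using y0 by (simp add: power2_eq_square field_simps)
    moreover have "R\<^sup>2 * (1 - y\<^sup>2) = \<rho>\<^sup>2 * (1 - x\<^sup>2)"
      using id R2 yR by algebra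
    moreover have "(1 - x\<^sup>2) * R\<^sup>2 * ((1 - y\<^sup>2) / 4) = (1 - x\<^sup>2) * (R\<^sup>2 * (1 - y\<^sup>2)) / 4" by simp
    ultimately show ?thesis by (simp add: power2_eq_square)
  qed
  also have "((\<rho> * (1 / 2) * (1 - x\<^sup>2))\<^sup>2) powr e = (\<rho> * (1 / 2) * (1 - x\<^sup>2)) powr (2 * e)"
    using rho x2 by (intro dbl[symmetric] mult_pos_pos) auto
  also have "\<dots> = \<rho> powr (2 * e) * 2 powr (- (2 * e)) * (1 - x\<^sup>2) powr (2 * e)"
    unfolding powr_mult by (simp add: powr_minus_divide powr_divide)
  finally show "(1 - x\<^sup>2) powr (\<mu> / 2 - 1 / 4) * R powr (\<mu> - 1 / 2) * (((1 + y) / (1 - y)) powr (1 / 4 - \<mu> / 2)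
        * ((1 + y) / 2) powr (\<mu> - 1 / 2)) =
      \<rho> powr (\<mu> - 1 / 2) * 2 powr (1 / 2 - \<mu>) * (1 - x\<^sup>2) powr (\<mu> - 1 / 2)"
    by (simp add: e_def)
qed

theorem mainTheorem20:
  fixes n :: nat and \<mu> \<rho> :: real and lam :: complex and R :: "real \<Rightarrow> real"
  assumes "- 1 / 2 < \<mu>" and "\<mu> \<noteq> 0" and "0 < \<rho>" and "\<rho> < 1"
    and R: "\<And>x. R x = sqrt (1 + \<rho>\<^sup>2 - 2 * \<rho> * x)"
  shows "((\<lambda>x::real.
             complex_of_real ((1 - x\<^sup>2) powr (\<mu> / 2 - 1 / 4))
               / complex_of_real (R x) powr (1 / 2 - complex_of_real \<mu> + lam)
             * ferrers_P (complex_of_real \<mu> - lam - 1 / 2) (1 / 2 - complex_of_real \<mu>)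
                 ((1 - \<rho> * x) / R x)
             * gegenbauer_C n (complex_of_real \<mu>) (complex_of_real x))
          has_integral
            (pochhammer lam n
             * complex_of_real (sqrt pi * \<rho> powr (real n + \<mu> - 1 / 2) * 2 powr (1 / 2 - \<mu>)
                 / ((real n + \<mu>) * Gamma \<mu> * fact n))))
         {-1..1}"
proof -
  note mu = assms(1,2) and rho = assms(3,4)
  define m where "m = complex_of_real \<mu>"
  define g where "g = Gamma (\<mu> + 1 / 2)"
  define K where "K = \<rho> powr (\<mu> - 1 / 2) * 2 powr (1 / 2 - \<mu>)"
  define C where "C = pochhammer (2 * m) n / fact n * of_real (K / g)"
  define T where "T x = of_real (R x) powr (- lam) *
      eval_fps (gauss_fps lam (2 * m - lam) (m + 1 / 2)) (of_real ((1 - (1 - \<rho> * x) / R x) / 2))" for x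
  define H where "H = pochhammer lam n / fact n * of_real \<rho> ^ n * (of_real (sqrt pi * g / Gamma (\<mu> + 1))
      * (fact n * m / (pochhammer (2 * m) n * (of_nat n + m))))"
  have I: "((\<lambda>x. of_real ((1 - x\<^sup>2) powr (\<mu> - 1 / 2)) * T x * zonal m n (of_real x)) has_integral H) {-1..1}"
    using generating_function_projection[OF mu, of \<rho> lam n] rho
    unfolding T_def H_def g_def m_def R by simp
  have "((\<lambda>x. C * (of_real ((1 - x\<^sup>2) powr (\<mu> - 1 / 2)) * T x * zonal m n (of_real x))) has_integral C * H) {-1..1}"
    by (rule has_integral_mult_right[OF I])
  then have "((\<lambda>x::real.
             complex_of_real ((1 - x\<^sup>2) powr (\<mu> / 2 - 1 / 4))
               / complex_of_real (R x) powr (1 / 2 - m + lam)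
             * ferrers_P (m - lam - 1 / 2) (1 / 2 - m) ((1 - \<rho> * x) / R x)
             * gegenbauer_C n m (complex_of_real x)) has_integral C * H) {-1..1}"
  \<comment> \<open>At the end points \<open>y = 1\<close>, where the Ferrers function is not meaningful.\<close>
  proof (rule has_integral_spike[where S = "{-1, 1}", rotated 2])
    show "negligible {-1, 1 :: real}" by simp
    fix x :: real assume "x \<in> {-1..1} - {-1, 1}"
    then have x: "-1 < x" "x < 1" by auto
    define y where "y = (1 - \<rho> * x) / R x"
    note W = weight_simplification[OF rho x, folded R, folded y_def]
    define F where "F = eval_fps (gauss_fps lam (2 * m - lam) (m + 1 / 2)) (of_real ((1 - y) / 2))"
    define p where "p = ((1 + y) / (1 - y)) powr (1 / 4 - \<mu> / 2) * ((1 + y) / 2) powr (\<mu> - 1 / 2)"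
    have "1 / 2 - m + lam = - (of_real (\<mu> - 1 / 2) + (- lam))" by (simp add: m_def)
    then have "1 / of_real (R x) powr (1 / 2 - m + lam) = of_real (R x) powr (of_real (\<mu> - 1 / 2) + (- lam))"
      by (simp only: powr_minus inverse_eq_divide) simp
    also have "\<dots> = of_real (R x powr (\<mu> - 1 / 2)) * of_real (R x) powr (- lam)"
      using W(1) by (simp only: powr_add powr_of_real less_imp_le)
    finally have "1 / complex_of_real (R x) powr (1 / 2 - m + lam) = of_real (R x powr (\<mu> - 1 / 2)) * of_real (R x) powr (- lam)" .
    then have "complex_of_real ((1 - x\<^sup>2) powr (\<mu> / 2 - 1 / 4)) / complex_of_real (R x) powr (1 / 2 - m + lam)
       = of_real ((1 - x\<^sup>2) powr (\<mu> / 2 - 1 / 4)) * (of_real (R x powr (\<mu> - 1 / 2)) * of_real (R x) powr (- lam))"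
      by (metis mult.right_neutral times_divide_eq_right)
    moreover have "ferrers_P (m - lam - 1 / 2) (1 / 2 - m) y = of_real (p / g) * F"
      unfolding p_def g_def F_def m_def by (rule ferrers_P_conv_gauss_fps[OF mu(1) W(2,3)])
    ultimately have "complex_of_real ((1 - x\<^sup>2) powr (\<mu> / 2 - 1 / 4))
               / complex_of_real (R x) powr (1 / 2 - m + lam)
             * ferrers_P (m - lam - 1 / 2) (1 / 2 - m) y * gegenbauer_C n m (complex_of_real x)
       = of_real ((1 - x\<^sup>2) powr (\<mu> / 2 - 1 / 4) * R x powr (\<mu> - 1 / 2) * p) / of_real g
          * (of_real (R x) powr (- lam) * F) * (pochhammer (2 * m) n / fact n * zonal m n (of_real x))"
      by (simp add: gegenbauer_C_eq_zonal)
    also have "(1 - x\<^sup>2) powr (\<mu> / 2 - 1 / 4) * R x powr (\<mu> - 1 / 2) * p = K * (1 - x\<^sup>2) powr (\<mu> - 1 / 2)"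
      unfolding p_def K_def by (rule W(4))
    also have "of_real (K * (1 - x\<^sup>2) powr (\<mu> - 1 / 2)) / of_real g
          * (of_real (R x) powr (- lam) * F) * (pochhammer (2 * m) n / fact n * zonal m n (of_real x))
       = C * (of_real ((1 - x\<^sup>2) powr (\<mu> - 1 / 2)) * T x * zonal m n (of_real x))"
      by (simp add: C_def T_def F_def y_def mult_ac)
    finally show "complex_of_real ((1 - x\<^sup>2) powr (\<mu> / 2 - 1 / 4))
               / complex_of_real (R x) powr (1 / 2 - m + lam)
             * ferrers_P (m - lam - 1 / 2) (1 / 2 - m) ((1 - \<rho> * x) / R x) * gegenbauer_C n m (complex_of_real x)
       = C * (of_real ((1 - x\<^sup>2) powr (\<mu> - 1 / 2)) * T x * zonal m n (of_real x))"
      unfolding y_def .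
  qed
  moreover have "C * H = pochhammer lam n
             * complex_of_real (sqrt pi * \<rho> powr (real n + \<mu> - 1 / 2) * 2 powr (1 / 2 - \<mu>)
                 / ((real n + \<mu>) * Gamma \<mu> * fact n))"
  proof -
    have poch: "pochhammer (2 * m) n \<noteq> 0"
      using add_nat_double_nonzero[OF mu] unfolding m_def by (auto simp: pochhammer_eq_0_iff) (metis add.left_inverse)
    have "g > 0" unfolding g_def by (rule Gamma_real_pos) (use mu in simp)
    then have g: "g \<noteq> 0" by simp
    have "\<mu> \<notin> \<int>\<^sub>\<le>\<^sub>0"
    proof
      assume "\<mu> \<in> \<int>\<^sub>\<le>\<^sub>0"
      then obtain k where "\<mu> = - real k" by (auto elim!: nonpos_Ints_cases')
      with mu show False by (cases k) auto
    qed
    then have G: "Gamma (\<mu> + 1) = \<mu> * Gamma \<mu>" by (rule Gamma_plus1)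
    have r: "\<rho> powr (real n + \<mu> - 1 / 2) = \<rho> ^ n * \<rho> powr (\<mu> - 1 / 2)"
      using rho powr_add[of \<rho> "real n" "\<mu> - 1 / 2"] by (simp add: powr_realpow add_diff_eq)
    have "C * H = pochhammer lam n * of_real \<rho> ^ n * of_real (K / g * (sqrt pi * g / Gamma (\<mu> + 1)))
        * (m / (fact n * (of_nat n + m)))"
      unfolding C_def H_def using poch by (simp add: mult_ac)
    also have "\<dots> = pochhammer lam n * of_real (\<rho> ^ n * (K / g * (sqrt pi * g / (\<mu> * Gamma \<mu>))) * (\<mu> / (fact n * (real n + \<mu>))))"
      by (simp add: m_def G)
    also have "\<rho> ^ n * (K / g * (sqrt pi * g / (\<mu> * Gamma \<mu>))) * (\<mu> / (fact n * (real n + \<mu>)))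
       = sqrt pi * \<rho> powr (real n + \<mu> - 1 / 2) * 2 powr (1 / 2 - \<mu>) / ((real n + \<mu>) * Gamma \<mu> * fact n)"
      unfolding r K_def using g mu by (simp add: mult_ac)
    finally show ?thesis .
  qed
  ultimately show ?thesis unfolding m_def by simp
qed

end
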